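(* Let $P>0$ and consider the Gaussian many-access channel in which all $k_n$ users are always active, with blocklength $n$ and $k_n=O(n)$. Then its symmetric message-length capacity is $B_1(n)=\frac{n}{2k_n}\log(1+k_nP)$. In particular, for every $\epsilon\in(0,1)$ there exists a sequence of codebooks with message lengths (in nats) $(1-\epsilon)B_1(n)$ whose average error probability tends to zero as $n\to\infty$.
   Context: Logarithms are natural. Channel: $\mathbf Y=\sum_{k=1}^{k_n}\mathbf s_k(W_k)+\mathbf Z\in\mathbb R^n$, $\mathbf Z$ i.i.d. standard Gaussian independent of the messages. A code with $M$ messages per user consists of codewords $\mathbf s_k(w)\in\mathbb R^n$, $w\in\{1,\dots,M\}$, with $\frac1n\sum_i s_{ki}(w)^2\le P$, and a decoder $\mathcal D:\mathbb R^n\to\{1,\dots,M\}^{k_n}$; the messages $W_1,\dots,W_{k_n}$ are independent and uniform on $\{1,\dots,M\}$, and the average error probability is $\mathsf P\{\mathcal D(\mathbf Y)\ne(W_1,\dots,W_{k_n})\}$. A positive nondecreasing $v(n)$ is asymptotically achievable if there are codes with $M=\lceil\exp(v(n))\rceil$ whose average error probability vanishes; $B(n)$ is a symmetric message-length capacity if for all $0<\epsilon<1$, $(1-\epsilon)B(n)$ is asymptotically achievable and $(1+\epsilon)B(n)$ is not. *)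

theory Defs
  imports "HOL-Probability.Probability" "HOL-Library.Landau_Symbols"
begin

text \<open>Blocklength n; vectors in R^n are functions nat => real restricted to {..<n}.
  A code for k users with M messages each: codewords s j w i (user j < k,
  message w in {1..M}, coordinate i < n) and a decoder D mapping a received
  vector to a message tuple (D y j = decoded message of user j).\<close>

definition noise :: "nat \<Rightarrow> (nat \<Rightarrow> real) measure" where
  "noise n = PiM {..<n} (\<lambda>_. density lborel std_normal_density)"

definition out_space :: "nat \<Rightarrow> (nat \<Rightarrow> real) measure" where
  "out_space n = PiM {..<n} (\<lambda>_. borel)"

definition channel_output ::
  "nat \<Rightarrow> nat \<Rightarrow> (nat \<Rightarrow> nat \<Rightarrow> nat \<Rightarrow> real) \<Rightarrow> (nat \<Rightarrow> nat) \<Rightarrow> (nat \<Rightarrow> real) \<Rightarrow> (nat \<Rightarrow> real)" where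
  "channel_output n k s w z = (\<lambda>i\<in>{..<n}. (\<Sum>j<k. s j (w j) i) + z i)"

definition valid_code ::
  "real \<Rightarrow> nat \<Rightarrow> nat \<Rightarrow> nat \<Rightarrow> (nat \<Rightarrow> nat \<Rightarrow> nat \<Rightarrow> real) \<Rightarrow> ((nat \<Rightarrow> real) \<Rightarrow> nat \<Rightarrow> nat) \<Rightarrow> bool" where
  "valid_code P n k M s D \<longleftrightarrow>
     (\<forall>j<k. \<forall>w\<in>{1..M}. (1 / real n) * (\<Sum>i<n. (s j w i)\<^sup>2) \<le> P) \<and>
     (\<forall>j m. {y \<in> space (out_space n). D y j = m} \<in> sets (out_space n))"

definition avg_error ::
  "nat \<Rightarrow> nat \<Rightarrow> nat \<Rightarrow> (nat \<Rightarrow> nat \<Rightarrow> nat \<Rightarrow> real) \<Rightarrow> ((nat \<Rightarrow> real) \<Rightarrow> nat \<Rightarrow> nat) \<Rightarrow> real" where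
  "avg_error n k M s D =
     (1 / real M ^ k) *
     (\<Sum>w\<in>PiE {..<k} (\<lambda>_. {1..M}).
        measure (noise n) {z \<in> space (noise n). \<exists>j<k. D (channel_output n k s w z) j \<noteq> w j})"

definition num_messages :: "real \<Rightarrow> nat" where
  "num_messages v = nat \<lceil>exp v\<rceil>"

definition asymp_achievable :: "real \<Rightarrow> (nat \<Rightarrow> nat) \<Rightarrow> (nat \<Rightarrow> real) \<Rightarrow> bool" where
  "asymp_achievable P k v \<longleftrightarrow>
     (\<exists>s D. (\<forall>n. valid_code P n (k n) (num_messages (v n)) (s n) (D n)) \<and>
            (\<lambda>n. avg_error n (k n) (num_messages (v n)) (s n) (D n)) \<longlonglongrightarrow> 0)"

definition sym_msg_length_capacity :: "real \<Rightarrow> (nat \<Rightarrow> nat) \<Rightarrow> (nat \<Rightarrow> real) \<Rightarrow> bool" where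
  "sym_msg_length_capacity P k B \<longleftrightarrow>
     (\<forall>\<epsilon>. 0 < \<epsilon> \<and> \<epsilon> < 1 \<longrightarrow>
        asymp_achievable P k (\<lambda>n. (1 - \<epsilon>) * B n) \<and>
        \<not> asymp_achievable P k (\<lambda>n. (1 + \<epsilon>) * B n))"

end

theory Submission
  imports Defs "HOL-Real_Asymp.Real_Asymp"
begin

text \<open>Write \<open>g d = ln (1 + d P)\<close>. Achievability uses i.i.d. Gaussian codewords of variance slightly below \<open>P\<close>
  and a decoder which, for every nonempty set \<open>T\<close> of \<open>d\<close> users, compares the information density of their
  codewords (given those of the others) with a threshold. A Chernoff bound makes the true tuple fail the test
  for \<open>T\<close> with probability \<open>exp (- c n g d)\<close> up to \<open>2 ^ d\<close>, because concavity of \<open>ln\<close> gives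
  \<open>(d / k) g k \<le> g d\<close>, so the rate constraint for \<open>d\<close> users has slack proportional to \<open>n g d\<close>; a change of
  measure does the same for the wrong tuples. Since \<open>k = O(n)\<close>, the number \<open>k choose d\<close> of sets is absorbed: for
  large \<open>d\<close> because \<open>g d\<close> exceeds any constant, and for bounded \<open>d\<close> because it is polynomial in \<open>n\<close>.

  The converse compares the output law with a product of \<open>N(m\<^sub>i, 1 + k P)\<close>, where \<open>m\<close> is the mean of the
  transmitted signal. The average relative entropy is at most \<open>(n / 2) g k\<close>, since the users' contributions are
  uncorrelated, and the decoding regions are disjoint, so \<open>k ln M\<close> times the probability of correct decoding
  is at most \<open>(n / 2) g k + 1\<close>.\<close>

section \<open>Gaussian integrals of the information density\<close>

text \<open>A growing number of users gives \<open>2 ^ k - 1\<close> error events, one per nonempty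
  set of users, so every estimate needs constants that are the same for all set sizes
  \<open>d\<close>. Two choices serve this. The threshold for size \<open>d\<close> is
  \<open>d * ln M\<close> plus \<open>\<epsilon> / 8 * n * g d\<close>: the first term cancels the
  at most \<open>M ^ d\<close> wrong tuples that differ from the true one exactly on that set, the
  second is the decay that survives. The Chernoff parameter \<open>s\<close> is a fixed small
  multiple of \<epsilon>: taking the moment of order \<open>- s\<close> of the likelihood ratio
  costs only a fraction of order \<open>s\<close> of the exponent, uniformly in the signal variance
  \<open>Q\<close>, because the second-order correction is itself bounded by a multiple of
  \<open>ln (1 + Q)\<close>. In the converse, the role of Fano's inequality is taken by one
  exponential inequality between the true and the reference output law, tested on a decoding region,
  with its weight set to the number of message tuples.\<close>

definition gauss :: "real \<Rightarrow> real measure" where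
  "gauss Q = density lborel (normal_density 0 (sqrt Q))"

lemma sets_gauss [simp, measurable_cong]: "sets (gauss Q) = sets borel"
  by (simp add: gauss_def)

lemma space_gauss [simp]: "space (gauss Q) = UNIV"
  by (simp add: gauss_def)

lemma prob_space_gauss: "Q > 0 \<Longrightarrow> prob_space (gauss Q)"
  unfolding gauss_def by (rule prob_space_normal_density) simp

lemma nn_integral_normal_density:
  "\<sigma> > 0 \<Longrightarrow> (\<integral>\<^sup>+x. ennreal (normal_density \<mu> \<sigma> x) \<partial>lborel) = 1"
  by (subst nn_integral_eq_integral) (auto simp: normal_density_nonneg)

text \<open>Completing the square: the weight turns \<open>N(0, Q)\<close> into a multiple of
  \<open>N(b R, R)\<close> with \<open>1 / R = 1 / Q + 2 a\<close>, and the integral is that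
  multiple. The condition \<open>1 + 2 a Q > 0\<close> says that \<open>R\<close> is positive;
  \<open>a\<close> itself may be negative.\<close>

lemma nn_integral_gauss_exp:
  assumes Q: "Q > 0" and a: "1 + 2 * a * Q > 0"
  shows "(\<integral>\<^sup>+x. ennreal (exp (b * x - a * x\<^sup>2)) \<partial>gauss Q) =
    ennreal (exp (b\<^sup>2 * Q / (2 * (1 + 2 * a * Q))) / sqrt (1 + 2 * a * Q))"
proof -
  define R where "R = Q / (1 + 2 * a * Q)"
  have R: "R > 0" using Q a by (simp add: R_def)
  have aR: "a = 1 / (2 * R) - 1 / (2 * Q)"
    using Q a by (simp add: R_def field_simps)
  have QR: "1 + 2 * a * Q = Q / R" using Q a by (simp add: R_def)
  define C where "C = exp (b\<^sup>2 * R / 2) / sqrt (Q / R)"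
  have "(\<integral>\<^sup>+x. ennreal (exp (b * x - a * x\<^sup>2)) \<partial>gauss Q) =
      (\<integral>\<^sup>+x. ennreal (normal_density 0 (sqrt Q) x) * ennreal (exp (b * x - a * x\<^sup>2)) \<partial>lborel)"
    unfolding gauss_def by (subst nn_integral_density) auto
  also have "\<dots> = (\<integral>\<^sup>+x. ennreal C * ennreal (normal_density (b * R) (sqrt R) x) \<partial>lborel)"
  proof (rule nn_integral_cong)
    fix x :: real
    have e: "- (x\<^sup>2) / (2 * Q) + (b * x - a * x\<^sup>2) = b\<^sup>2 * R / 2 - (x - b * R)\<^sup>2 / (2 * R)"
      using Q R unfolding aR by (simp add: field_simps power2_eq_square)
    have "normal_density 0 (sqrt Q) x * exp (b * x - a * x\<^sup>2) =
        1 / sqrt (2 * pi * Q) * exp (- (x\<^sup>2) / (2 * Q) + (b * x - a * x\<^sup>2))"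
      using Q unfolding exp_add by (simp add: normal_density_def)
    also have "\<dots> = 1 / sqrt (2 * pi * Q) * (exp (b\<^sup>2 * R / 2) * exp (- (x - b * R)\<^sup>2 / (2 * R)))"
      unfolding e by (simp add: mult_exp_exp)
    also have "\<dots> = C * normal_density (b * R) (sqrt R) x"
      using Q R by (simp add: normal_density_def C_def real_sqrt_divide real_sqrt_mult)
    finally show "ennreal (normal_density 0 (sqrt Q) x) * ennreal (exp (b * x - a * x\<^sup>2)) =
        ennreal C * ennreal (normal_density (b * R) (sqrt R) x)"
      by (simp add: C_def Q R less_imp_le flip: ennreal_mult)
  qed
  also have "\<dots> = ennreal C"
    using R by (simp add: nn_integral_cmult nn_integral_normal_density)
  also have "C = exp (b\<^sup>2 * Q / (2 * (1 + 2 * a * Q))) / sqrt (1 + 2 * a * Q)"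
    unfolding C_def QR using Q R by (simp add: field_simps)
  finally show ?thesis .
qed

text \<open>The log-likelihood ratio of \<open>N(x, 1)\<close> to \<open>N(0, 1 + Q)\<close> at \<open>y\<close>.\<close>

definition info :: "real \<Rightarrow> real \<Rightarrow> real \<Rightarrow> real" where
  "info Q x y = ln (1 + Q) / 2 + y\<^sup>2 / (2 * (1 + Q)) - (y - x)\<^sup>2 / 2"

lemma borel_measurable_info [measurable (raw)]:
  assumes [measurable]: "f \<in> borel_measurable N" "g \<in> borel_measurable N"
  shows "(\<lambda>w. info Q (f w) (g w)) \<in> borel_measurable N"
  unfolding info_def by measurable

text \<open>As a function of \<open>x\<close>, \<open>exp (info Q x y)\<close> is the likelihood of
  \<open>y\<close> under \<open>N(x, 1)\<close> divided by its average over the input law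
  \<open>N(0, Q)\<close>, which is the density of \<open>N(0, 1 + Q)\<close> at \<open>y\<close>. A
  codeword independent of the output thus has mean weight 1 whatever \<open>y\<close> is, which
  disposes of the wrong tuples.\<close>

lemma nn_integral_exp_info:
  assumes Q: "Q > 0"
  shows "(\<integral>\<^sup>+x. ennreal (exp (info Q x y)) \<partial>gauss Q) = 1"
proof -
  define C where "C = exp (ln (1 + Q) / 2 + y\<^sup>2 / (2 * (1 + Q)) - y\<^sup>2 / 2)"
  have "(\<integral>\<^sup>+x. ennreal (exp (info Q x y)) \<partial>gauss Q) =
      (\<integral>\<^sup>+x. ennreal C * ennreal (exp (y * x - (1/2) * x\<^sup>2)) \<partial>gauss Q)"
    by (intro nn_integral_cong)
       (simp add: C_def info_def power2_eq_square field_simps flip: ennreal_mult exp_add)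
  also have "\<dots> = ennreal C * ennreal (exp (y\<^sup>2 * Q / (2 * (1 + Q))) / sqrt (1 + Q))"
    using nn_integral_gauss_exp[of Q "1/2" y] Q by (simp add: nn_integral_cmult)
  also have "\<dots> = ennreal (C * exp (y\<^sup>2 * Q / (2 * (1 + Q))) / sqrt (1 + Q))"
    using Q by (simp add: C_def flip: ennreal_mult)
  also have "C * exp (y\<^sup>2 * Q / (2 * (1 + Q))) = exp (ln (1 + Q) / 2)"
  proof -
    have "y\<^sup>2 / (2 * (1 + Q)) + y\<^sup>2 * Q / (2 * (1 + Q)) = y\<^sup>2 / 2"
      using Q by (simp add: divide_eq_eq add_divide_distrib[symmetric]) (simp add: algebra_simps)
    then show ?thesis unfolding C_def exp_add[symmetric] by simp
  qed
  also have "\<dots> = sqrt (1 + Q)"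
    using Q by (simp add: ln_sqrt[symmetric])
  finally show ?thesis using Q by simp
qed

text \<open>Both integrals are Gaussian, and the exact value is
  \<open>(1 + Q) powr (- s / 2) / sqrt (1 - s\<^sup>2 * r)\<close> with
  \<open>r = Q / (1 + Q)\<close>. The root is a correction of second order in \<open>s\<close>;
  since \<open>r \<le> ln (1 + Q)\<close>, it costs a fraction of the main exponent that is the same
  for every \<open>Q\<close>.\<close>

lemma nn_integral_exp_neg_info:
  assumes Q: "Q > 0" and s: "0 < s" "s < 1"
  shows "(\<integral>\<^sup>+x. (\<integral>\<^sup>+v. ennreal (exp (- s * info Q x (x + v))) \<partial>gauss 1) \<partial>gauss Q)
    \<le> ennreal (exp (- (s / 2) * (1 - s / (1 - s\<^sup>2)) * ln (1 + Q)))"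
proof -
  define r where "r = Q / (1 + Q)"
  have r: "0 < r" "r < 1" using Q by (auto simp: r_def)
  have Qr: "1 / (1 + Q) = 1 - r" "Q * (1 - r) = r" using Q by (auto simp: r_def field_simps)
  have sr: "s * r < 1" using mult_strict_mono[of s 1 r 1] s r by simp
  have s2: "s\<^sup>2 < 1" using mult_strict_mono[of s 1 s 1] s by (simp add: power2_eq_square)
  have s2r: "s\<^sup>2 * r < 1" "s\<^sup>2 < 1" using mult_strict_mono[of "s\<^sup>2" 1 r 1] s2 r by simp_all
  define D where "D = exp (- s * ln (1 + Q) / 2)"
  \<comment> \<open>\<open>X\<close> is the coefficient of \<open>- x\<^sup>2 / 2\<close> that
    remains once the noise \<open>v\<close> is integrated out.\<close>
  define X where "X = s * (1 - r) * (1 - s) / (1 - s * r)"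
  define a where "a = X / 2"
  have inner: "(\<integral>\<^sup>+v. ennreal (exp (- s * info Q x (x + v))) \<partial>gauss 1)
      = ennreal (D / sqrt (1 - s * r)) * ennreal (exp (0 * x - a * x\<^sup>2))" for x
  proof -
    have "(\<integral>\<^sup>+v. ennreal (exp (- s * info Q x (x + v))) \<partial>gauss 1) =
      (\<integral>\<^sup>+v. ennreal (D * exp (- s * (1 - r) * x\<^sup>2 / 2)) *
         ennreal (exp ((- s * x * (1 - r)) * v - (- s * r / 2) * v\<^sup>2)) \<partial>gauss 1)"
    proof (intro nn_integral_cong)
      fix v :: real
      have "(x + v)\<^sup>2 / (2 * (1 + Q)) = (x + v)\<^sup>2 * (1 - r) / 2"
        unfolding Qr(1)[symmetric] by simp
      then have "- s * info Q x (x + v) = - s * ln (1 + Q) / 2 + (- s * (1 - r) * x\<^sup>2 / 2)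
          + ((- s * x * (1 - r)) * v - (- s * r / 2) * v\<^sup>2)"
        unfolding info_def by (simp only:) (simp add: power2_eq_square algebra_simps add_divide_distrib diff_divide_distrib)
      then show "ennreal (exp (- s * info Q x (x + v))) = ennreal (D * exp (- s * (1 - r) * x\<^sup>2 / 2)) *
         ennreal (exp ((- s * x * (1 - r)) * v - (- s * r / 2) * v\<^sup>2))"
        by (simp add: D_def exp_add[symmetric] flip: ennreal_mult)
    qed
    also have "\<dots> = ennreal (D * exp (- s * (1 - r) * x\<^sup>2 / 2)) *
        ennreal (exp ((- s * x * (1 - r))\<^sup>2 * 1 / (2 * (1 + 2 * (- s * r / 2) * 1))) / sqrt (1 + 2 * (- s * r / 2) * 1))"
      using sr by (subst nn_integral_cmult, simp, subst nn_integral_gauss_exp) simp_all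
    also have "\<dots> = ennreal (D / sqrt (1 - s * r) * (exp (- s * (1 - r) * x\<^sup>2 / 2) *
        exp ((s * x * (1 - r))\<^sup>2 / (2 * (1 - s * r)))))"
      using sr by (simp add: D_def flip: ennreal_mult)
    also have "exp (- s * (1 - r) * x\<^sup>2 / 2) * exp ((s * x * (1 - r))\<^sup>2 / (2 * (1 - s * r))) = exp (0 * x - a * x\<^sup>2)"
      unfolding exp_add[symmetric] a_def X_def using sr by (simp add: field_simps power2_eq_square)
    finally show ?thesis using sr by (simp add: D_def flip: ennreal_mult)
  qed
  have "2 * a * Q = s * r * (1 - s) / (1 - s * r)"
  proof -
    have "2 * a * Q = s * (Q * (1 - r)) * (1 - s) / (1 - s * r)"
    proof -
      have "2 * a * Q = X * Q" by (simp add: a_def)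
      then show ?thesis by (simp add: X_def)
    qed
    then show ?thesis unfolding Qr(2) .
  qed
  \<comment> \<open>The denominator \<open>1 - s * r\<close> is the one under the root of the inner
    integral, so the two cancel and only \<open>1 - s\<^sup>2 * r\<close> is left.\<close>
  then have aQ: "1 + 2 * a * Q = (1 - s\<^sup>2 * r) / (1 - s * r)"
    using sr by (simp add: field_simps power2_eq_square)
  have aQ0: "1 + 2 * a * Q > 0" unfolding aQ using sr s2r by simp
  have "(\<integral>\<^sup>+x. (\<integral>\<^sup>+v. ennreal (exp (- s * info Q x (x + v))) \<partial>gauss 1) \<partial>gauss Q) =
      ennreal (D / sqrt (1 - s * r)) * ennreal (1 / sqrt (1 + 2 * a * Q))"
    unfolding inner using aQ0 Q by (subst nn_integral_cmult, simp, subst nn_integral_gauss_exp) simp_all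
  also have "\<dots> = ennreal (D / sqrt (1 - s\<^sup>2 * r))"
    unfolding aQ using sr s2r by (simp add: D_def real_sqrt_divide flip: ennreal_mult)
  also have "\<dots> \<le> ennreal (exp (- (s / 2) * (1 - s / (1 - s\<^sup>2)) * ln (1 + Q)))"
  proof (rule ennreal_leI)
    have rle: "r \<le> ln (1 + Q)"
    proof -
      have "ln (1 - r) \<le> (1 - r) - 1" using r by (intro ln_le_minus_one) simp
      moreover have "ln (1 - r) = - ln (1 + Q)" using Q by (simp add: Qr(1)[symmetric] ln_div)
      ultimately show ?thesis by simp
    qed
    have "- ln (1 - s\<^sup>2 * r) \<le> s\<^sup>2 * r / (1 - s\<^sup>2 * r)"
    proof -
      have "ln (1 / (1 - s\<^sup>2 * r)) \<le> 1 / (1 - s\<^sup>2 * r) - 1"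
        using s2r by (intro ln_le_minus_one) simp
      also have "ln (1 / (1 - s\<^sup>2 * r)) = - ln (1 - s\<^sup>2 * r)" using s2r by (simp add: ln_div)
      also have "1 / (1 - s\<^sup>2 * r) - 1 = s\<^sup>2 * r / (1 - s\<^sup>2 * r)" using s2r by (simp add: divide_simps)
      finally show ?thesis .
    qed
    moreover have "s\<^sup>2 * r / (1 - s\<^sup>2 * r) \<le> s\<^sup>2 * r / (1 - s\<^sup>2)"
    proof (rule divide_left_mono)
      show "1 - s\<^sup>2 \<le> 1 - s\<^sup>2 * r" using mult_left_le[of r "s\<^sup>2"] r by simp
    qed (use r s2r in simp_all)
    moreover have "s\<^sup>2 * r / (1 - s\<^sup>2) \<le> s\<^sup>2 * ln (1 + Q) / (1 - s\<^sup>2)"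
      by (rule divide_right_mono[OF mult_left_mono[OF rle]]) (use s2r in simp_all)
    ultimately have *: "- ln (1 - s\<^sup>2 * r) \<le> s\<^sup>2 * ln (1 + Q) / (1 - s\<^sup>2)" by linarith
    have "D / sqrt (1 - s\<^sup>2 * r) = exp (- s * ln (1 + Q) / 2 + - ln (1 - s\<^sup>2 * r) / 2)"
    proof -
      have "- ln (1 - s\<^sup>2 * r) / 2 = - ln (sqrt (1 - s\<^sup>2 * r))" using s2r by (simp add: ln_sqrt)
      then have "exp (- ln (1 - s\<^sup>2 * r) / 2) = inverse (sqrt (1 - s\<^sup>2 * r))"
        using s2r by (simp only: exp_minus) simp
      then show ?thesis unfolding exp_add D_def by (simp only: divide_inverse)
    qed
    also have "\<dots> \<le> exp (- (s / 2) * (1 - s / (1 - s\<^sup>2)) * ln (1 + Q))"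
    proof -
      have "- s * ln (1 + Q) / 2 + (s\<^sup>2 * ln (1 + Q) / (1 - s\<^sup>2)) / 2 = - (s / 2) * (1 - s / (1 - s\<^sup>2)) * ln (1 + Q)"
        using s2r(2) by (simp add: field_simps power2_eq_square)
      moreover have "- ln (1 - s\<^sup>2 * r) / 2 \<le> s\<^sup>2 * ln (1 + Q) / (1 - s\<^sup>2) / 2"
        using * by (intro divide_right_mono) simp_all
      ultimately show ?thesis by (metis exp_le_cancel_iff add_left_mono)
    qed
    finally show "D / sqrt (1 - s\<^sup>2 * r) \<le> exp (- (s / 2) * (1 - s / (1 - s\<^sup>2)) * ln (1 + Q))" .
  qed
  finally show ?thesis .
qed

section \<open>Sums of independent Gaussian codebook entries\<close>

lemma product_prob_space_gauss: "Q > 0 \<Longrightarrow> product_prob_space (\<lambda>_. gauss Q)"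
  by (intro product_prob_spaceI prob_space_gauss)

text \<open>The coordinates of a product measure are independent because their joint law is the
  measure itself; the law of a sum of independent normals then applies. This turns the superposition
  of the users in a set into a single Gaussian variable.\<close>

lemma nn_integral_iid_sum:
  assumes Q: "Q > 0" and A: "finite A" "A \<noteq> {}" and f [measurable]: "f \<in> borel_measurable borel"
  shows "(\<integral>\<^sup>+c. f (\<Sum>a\<in>A. c a) \<partial>PiM A (\<lambda>_. gauss Q)) = (\<integral>\<^sup>+x. f x \<partial>gauss (real (card A) * Q))"
proof -
  interpret P: product_prob_space "\<lambda>_. gauss Q" A by (rule product_prob_space_gauss[OF Q])
  let ?M = "PiM A (\<lambda>_. gauss Q)"
  have comp: "distr ?M borel (\<lambda>c. c a) = gauss Q" if "a \<in> A" for a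
  proof -
    have "distr ?M borel (\<lambda>c. c a) = distr ?M (gauss Q) (\<lambda>c. c a)"
      by (rule distr_cong) auto
    also have "\<dots> = gauss Q" by (rule P.PiM_component[OF that])
    finally show ?thesis .
  qed
  have sets: "sets ?M = sets (PiM A (\<lambda>_. borel))" by (intro sets_PiM_cong) auto
  have m: "(\<lambda>c. c a) \<in> borel_measurable ?M" if "a \<in> A" for a
    using that by measurable
  have "P.P.indep_vars (\<lambda>_. borel) (\<lambda>a c. c a) A"
  proof (subst P.P.indep_vars_iff_distr_eq_PiM'[OF A(2) m])
    have "distr ?M (PiM A (\<lambda>_. borel)) (\<lambda>c. \<lambda>a\<in>A. c a) = distr ?M ?M (\<lambda>c. c)"
      by (rule distr_cong) (auto simp: sets space_PiM PiE_def extensional_restrict)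
    also have "\<dots> = ?M" by (rule distr_id)
    also have "\<dots> = PiM A (\<lambda>a. distr ?M borel (\<lambda>c. c a))"
      by (rule PiM_cong) (auto simp: comp)
    finally show "distr ?M (PiM A (\<lambda>_. borel)) (\<lambda>c. \<lambda>a\<in>A. c a) = PiM A (\<lambda>a. distr ?M borel (\<lambda>c. c a))" .
  qed
  moreover have "distributed ?M lborel (\<lambda>c. c a) (normal_density 0 (sqrt Q))" if "a \<in> A" for a
    unfolding distributed_def using comp[OF that] m[OF that]
    by (simp add: gauss_def cong: distr_cong)
  ultimately have "distributed ?M lborel (\<lambda>c. \<Sum>a\<in>A. c a)
      (normal_density (\<Sum>a\<in>A. 0) (sqrt (\<Sum>a\<in>A. (sqrt Q)\<^sup>2)))"
    using A Q by (intro P.P.sum_indep_normal) auto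
  then have d: "distr ?M lborel (\<lambda>c. \<Sum>a\<in>A. c a) = gauss (real (card A) * Q)"
    using Q by (simp add: distributed_def gauss_def)
  have "(\<integral>\<^sup>+x. f x \<partial>gauss (real (card A) * Q)) = (\<integral>\<^sup>+c. f (\<Sum>a\<in>A. c a) \<partial>?M)"
    unfolding d[symmetric] by (rule nn_integral_distr) measurable
  then show ?thesis ..
qed

lemma borel_measurable_sum_components:
  "A \<subseteq> L \<Longrightarrow> (\<lambda>c. \<Sum>a\<in>A. c a) \<in> borel_measurable (PiM L (\<lambda>_. gauss Q))"
proof (intro borel_measurable_sum)
  fix a assume "A \<subseteq> L" "a \<in> A"
  then have "a \<in> L" by auto
  then show "(\<lambda>c. c a) \<in> borel_measurable (PiM L (\<lambda>_. gauss Q))" by measurable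
qed

lemma nn_integral_restrict_components:
  assumes Q: "Q > 0" and J: "finite J" "A \<subseteq> J" and g: "g \<in> borel_measurable (PiM A (\<lambda>_. gauss Q))"
  shows "(\<integral>\<^sup>+c. g (restrict c A) \<partial>PiM J (\<lambda>_. gauss Q)) = (\<integral>\<^sup>+c. g c \<partial>PiM A (\<lambda>_. gauss Q))"
proof -
  interpret P: product_prob_space "\<lambda>_. gauss Q" J by (rule product_prob_space_gauss[OF Q])
  have "(\<integral>\<^sup>+c. g c \<partial>PiM A (\<lambda>_. gauss Q)) =
      integral\<^sup>N (distr (PiM J (\<lambda>_. gauss Q)) (PiM A (\<lambda>_. gauss Q)) (\<lambda>c. restrict c A)) g"
    by (rule arg_cong[OF P.distr_restrict[OF J(2) J(1)]])
  also have "\<dots> = (\<integral>\<^sup>+c. g (restrict c A) \<partial>PiM J (\<lambda>_. gauss Q))"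
    using g by (intro nn_integral_distr measurable_restrict_subset J(2)) simp
  finally show ?thesis ..
qed

lemma nn_integral_iid_sum_subset:
  assumes Q: "Q > 0" and J: "finite J" "A \<subseteq> J" "A \<noteq> {}" and f [measurable]: "f \<in> borel_measurable borel"
  shows "(\<integral>\<^sup>+c. f (\<Sum>a\<in>A. c a) \<partial>PiM J (\<lambda>_. gauss Q)) = (\<integral>\<^sup>+x. f x \<partial>gauss (real (card A) * Q))"
proof -
  have "(\<integral>\<^sup>+x. f x \<partial>gauss (real (card A) * Q)) = (\<integral>\<^sup>+c. f (\<Sum>a\<in>A. c a) \<partial>PiM A (\<lambda>_. gauss Q))"
    using J by (intro nn_integral_iid_sum[OF Q, symmetric]) (auto intro: finite_subset)
  also have "\<dots> = (\<integral>\<^sup>+c. f (\<Sum>a\<in>A. restrict c A a) \<partial>PiM J (\<lambda>_. gauss Q))"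
    by (rule nn_integral_restrict_components[OF Q J(1,2), symmetric])
       (rule measurable_compose[OF borel_measurable_sum_components f], simp)
  finally show ?thesis by simp
qed

text \<open>Disjoint blocks of coordinates are independent, so their sums can be integrated one
  after the other. The blocks in mind are the true and the wrong codewords of the users on which two
  message tuples differ.\<close>

lemma nn_integral_iid_two_sums:
  assumes Q: "Q > 0" and J: "finite J" "A \<subseteq> J" "B \<subseteq> J" "A \<noteq> {}" "B \<noteq> {}" "A \<inter> B = {}"
    and f [measurable]: "case_prod f \<in> borel_measurable (borel \<Otimes>\<^sub>M borel)"
  shows "(\<integral>\<^sup>+c. f (\<Sum>a\<in>A. c a) (\<Sum>b\<in>B. c b) \<partial>PiM J (\<lambda>_. gauss Q)) =
    (\<integral>\<^sup>+x. (\<integral>\<^sup>+y. f x y \<partial>gauss (real (card B) * Q)) \<partial>gauss (real (card A) * Q))"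
proof -
  interpret P: product_prob_space "\<lambda>_. gauss Q" J by (rule product_prob_space_gauss[OF Q])
  have fin: "finite A" "finite B" using J by (auto intro: finite_subset)
  have sub: "A \<union> B \<subseteq> J" using J by auto
  note [measurable] = borel_measurable_sum_components
  let ?B = "gauss (real (card B) * Q)"
  interpret B: prob_space ?B using Q fin J by (intro prob_space_gauss) (auto simp: card_gt_0_iff)
  have fb: "f x \<in> borel_measurable borel" for x by measurable
  have fi: "(\<lambda>x. \<integral>\<^sup>+y. f x y \<partial>?B) \<in> borel_measurable borel"
    by (rule B.borel_measurable_nn_integral) measurable
  have mf: "(\<lambda>c. f (\<Sum>a\<in>A. c a) (\<Sum>b\<in>B. c b)) \<in> borel_measurable (PiM (A \<union> B) (\<lambda>_. gauss Q))"
  proof -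
    have "(\<lambda>c. (\<Sum>a\<in>A. c a, \<Sum>b\<in>B. c b)) \<in> PiM (A \<union> B) (\<lambda>_. gauss Q) \<rightarrow>\<^sub>M borel \<Otimes>\<^sub>M borel"
      by (intro measurable_Pair borel_measurable_sum_components) auto
    from measurable_compose[OF this f] show ?thesis by simp
  qed
  have "(\<integral>\<^sup>+c. f (\<Sum>a\<in>A. c a) (\<Sum>b\<in>B. c b) \<partial>PiM J (\<lambda>_. gauss Q)) =
     (\<integral>\<^sup>+c. f (\<Sum>a\<in>A. restrict c (A \<union> B) a) (\<Sum>b\<in>B. restrict c (A \<union> B) b) \<partial>PiM J (\<lambda>_. gauss Q))"
    by simp
  also have "\<dots> = (\<integral>\<^sup>+c. f (\<Sum>a\<in>A. c a) (\<Sum>b\<in>B. c b) \<partial>PiM (A \<union> B) (\<lambda>_. gauss Q))"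
    by (rule nn_integral_restrict_components[OF Q J(1) sub mf])
  also have "\<dots> = (\<integral>\<^sup>+c. (\<integral>\<^sup>+d. f (\<Sum>a\<in>A. merge A B (c, d) a) (\<Sum>b\<in>B. merge A B (c, d) b) \<partial>PiM B (\<lambda>_. gauss Q)) \<partial>PiM A (\<lambda>_. gauss Q))"
    by (rule P.product_nn_integral_fold[OF J(6) fin mf])
  also have "\<dots> = (\<integral>\<^sup>+c. (\<integral>\<^sup>+d. f (\<Sum>a\<in>A. c a) (\<Sum>b\<in>B. d b) \<partial>PiM B (\<lambda>_. gauss Q)) \<partial>PiM A (\<lambda>_. gauss Q))"
  proof -
    have "(\<Sum>a\<in>A. merge A B (c, d) a) = (\<Sum>a\<in>A. c a)" "(\<Sum>b\<in>B. merge A B (c, d) b) = (\<Sum>b\<in>B. d b)" for c d :: "_ \<Rightarrow> real"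
      using J(6) by (auto intro!: sum.cong simp: merge_def)
    then show ?thesis by simp
  qed
  also have "\<dots> = (\<integral>\<^sup>+c. (\<integral>\<^sup>+y. f (\<Sum>a\<in>A. c a) y \<partial>?B) \<partial>PiM A (\<lambda>_. gauss Q))"
    using nn_integral_iid_sum[OF Q fin(2) J(5) fb] by simp
  also have "\<dots> = (\<integral>\<^sup>+x. (\<integral>\<^sup>+y. f x y \<partial>?B) \<partial>gauss (real (card A) * Q))"
    by (rule nn_integral_iid_sum[OF Q fin(1) J(4) fi])
  finally show ?thesis .
qed

section \<open>Threshold decoding and random coding\<close>

definition message_tuples :: "nat \<Rightarrow> nat \<Rightarrow> (nat \<Rightarrow> nat) set" where
  "message_tuples k M = PiE {..<k} (\<lambda>_. {1..M})"

text \<open>A codebook \<open>c\<close> takes the time index first: \<open>c i (j, m)\<close> is the \<open>i\<close>th symbol of codeword \<open>m\<close> of user \<open>j\<close>.\<close>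

definition part_signal :: "(nat \<Rightarrow> nat \<times> nat \<Rightarrow> real) \<Rightarrow> nat set \<Rightarrow> (nat \<Rightarrow> nat) \<Rightarrow> nat \<Rightarrow> real" where
  "part_signal c T w i = (\<Sum>j\<in>T. c i (j, w j))"

text \<open>Conditional information density of the users in \<open>T\<close> given the others:
  subtracting the codewords of the other users leaves a Gaussian channel whose input, a sum of
  \<open>card T\<close> symbols of variance \<open>V\<close>, has variance
  \<open>card T * V\<close>.\<close>

definition total_info ::
  "nat \<Rightarrow> nat \<Rightarrow> real \<Rightarrow> (nat \<Rightarrow> nat \<times> nat \<Rightarrow> real) \<Rightarrow> nat set \<Rightarrow> (nat \<Rightarrow> nat) \<Rightarrow> (nat \<Rightarrow> real) \<Rightarrow> real" where
  "total_info n k V c T w y =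
     (\<Sum>i<n. info (real (card T) * V) (part_signal c T w i) (y i - part_signal c ({..<k} - T) w i))"

definition accepts ::
  "nat \<Rightarrow> nat \<Rightarrow> real \<Rightarrow> (nat \<Rightarrow> real) \<Rightarrow> (nat \<Rightarrow> nat \<times> nat \<Rightarrow> real) \<Rightarrow> (nat \<Rightarrow> nat) \<Rightarrow> (nat \<Rightarrow> real) \<Rightarrow> bool" where
  "accepts n k V \<gamma> c w y \<longleftrightarrow>
     (\<forall>T\<in>Pow {..<k} - {{}}. \<gamma> (card T) < total_info n k V c T w y)"

text \<open>At most one summand is nonzero, so the sum returns the accepted tuple if it is unique.\<close>

definition threshold_decoder ::
  "nat \<Rightarrow> nat \<Rightarrow> nat \<Rightarrow> real \<Rightarrow> (nat \<Rightarrow> real) \<Rightarrow> (nat \<Rightarrow> nat \<times> nat \<Rightarrow> real) \<Rightarrow> (nat \<Rightarrow> real) \<Rightarrow> nat \<Rightarrow> nat" where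
  "threshold_decoder n k M V \<gamma> c y j =
     (\<Sum>w\<in>message_tuples k M.
        if accepts n k V \<gamma> c w y \<and> (\<forall>w'\<in>message_tuples k M - {w}. \<not> accepts n k V \<gamma> c w' y)
        then w j else 0)"

text \<open>Codewords that violate the power constraint are replaced by \<open>0\<close>, but only in the encoder: the decoder keeps
  working with \<open>c\<close>, and the transmission of a replaced codeword is counted as an error.\<close>

definition expurgate :: "nat \<Rightarrow> real \<Rightarrow> (nat \<Rightarrow> nat \<times> nat \<Rightarrow> real) \<Rightarrow> nat \<Rightarrow> nat \<Rightarrow> nat \<Rightarrow> real" where
  "expurgate n P c j m i = (if (\<Sum>i<n. (c i (j, m))\<^sup>2) \<le> real n * P then c i (j, m) else 0)"

section \<open>Correctness and measurability of the decoder, and the power constraint\<close>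

lemma finite_message_tuples [simp]: "finite (message_tuples k M)"
  by (simp add: message_tuples_def finite_PiE)

lemma card_message_tuples [simp]: "card (message_tuples k M) = M ^ k"
  by (simp add: message_tuples_def card_PiE)

lemma message_tuples_diff_nonempty:
  assumes "w \<in> message_tuples k M" "w' \<in> message_tuples k M" "w \<noteq> w'"
  shows "{j\<in>{..<k}. w j \<noteq> w' j} \<noteq> {}"
proof
  assume "{j\<in>{..<k}. w j \<noteq> w' j} = {}"
  then have "w j = w' j" if "j \<in> {..<k}" for j using that by blast
  then have "w = w'" using assms(1,2) unfolding message_tuples_def by (intro PiE_ext)
  with assms(3) show False by simp
qed

lemma threshold_decoder_eq:
  assumes "w \<in> message_tuples k M" "accepts n k V \<gamma> c w y"
    "\<forall>w'\<in>message_tuples k M - {w}. \<not> accepts n k V \<gamma> c w' y"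
  shows "threshold_decoder n k M V \<gamma> c y j = w j"
proof -
  have "threshold_decoder n k M V \<gamma> c y j = (\<Sum>w'\<in>message_tuples k M. if w' = w then w j else 0)"
    unfolding threshold_decoder_def using assms by (intro sum.cong) auto
  then show ?thesis using assms(1) by simp
qed

lemma measurable_threshold_decoder:
  "{y \<in> space (out_space n). threshold_decoder n k M V \<gamma> c y j = m} \<in> sets (out_space n)"
proof -
  have [measurable]: "(\<lambda>y. y i) \<in> borel_measurable (out_space n)" if "i < n" for i
    unfolding out_space_def using that by (intro measurable_component_singleton) simp
  have [measurable]: "(\<lambda>y. total_info n k V c T w y) \<in> borel_measurable (out_space n)" for T w
    unfolding total_info_def by (intro borel_measurable_sum borel_measurable_info) auto
  have [measurable]: "Measurable.pred (out_space n) (accepts n k V \<gamma> c w)" for w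
    unfolding accepts_def by measurable
  have "(\<lambda>y. threshold_decoder n k M V \<gamma> c y j) \<in> borel_measurable (out_space n)"
    unfolding threshold_decoder_def by (intro borel_measurable_sum) measurable
  then have "(\<lambda>y. threshold_decoder n k M V \<gamma> c y j) -` {m} \<inter> space (out_space n) \<in> sets (out_space n)"
    by (rule measurable_sets) simp
  moreover have "(\<lambda>y. threshold_decoder n k M V \<gamma> c y j) -` {m} \<inter> space (out_space n) =
      {y \<in> space (out_space n). threshold_decoder n k M V \<gamma> c y j = m}"
    by auto
  ultimately show ?thesis by simp
qed

lemma valid_code_expurgate:
  assumes "P \<ge> 0"
  shows "valid_code P n k M (expurgate n P c) (threshold_decoder n k M V \<gamma> c)"
proof -
  have "(1 / real n) * (\<Sum>i<n. (expurgate n P c j m i)\<^sup>2) \<le> P" for j m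
  proof (cases "n = 0")
    case False
    have "(\<Sum>i<n. (expurgate n P c j m i)\<^sup>2) \<le> real n * P"
      using assms by (cases "(\<Sum>i<n. (c i (j, m))\<^sup>2) \<le> real n * P") (simp_all add: expurgate_def)
    with False show ?thesis by (simp add: field_simps)
  qed (use assms in simp)
  then show ?thesis unfolding valid_code_def using measurable_threshold_decoder by blast
qed

text \<open>A pointwise majorant of the error indicator made of Chernoff weights, for three kinds of
  event: the true tuple fails the test for \<open>T\<close>; a wrong tuple passes the test for the
  set on which it differs from the true one (its other tests are ignored); a transmitted codeword
  exceeds the power limit. Every weight is a product over time, so its mean will be an
  \<open>n\<close>th power. The signals are those of the unmodified codebook \<open>c\<close>, which
  agree with what is sent unless the third sum already reaches 1.\<close>

definition error_bound ::
  "nat \<Rightarrow> nat \<Rightarrow> nat \<Rightarrow> real \<Rightarrow> real \<Rightarrow> (nat \<Rightarrow> real) \<Rightarrow> real \<Rightarrow> real \<Rightarrow>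
   (nat \<Rightarrow> nat) \<Rightarrow> (nat \<Rightarrow> nat \<times> nat \<Rightarrow> real) \<Rightarrow> (nat \<Rightarrow> real) \<Rightarrow> ennreal" where
  "error_bound n k M P V \<gamma> s t w c z =
     (\<Sum>T\<in>Pow {..<k} - {{}}. ennreal (exp (s * \<gamma> (card T))) *
        (\<Prod>i<n. ennreal (exp (- s * info (real (card T) * V) (part_signal c T w i) (part_signal c T w i + z i))))) +
     (\<Sum>w'\<in>message_tuples k M - {w}. let T = {j\<in>{..<k}. w j \<noteq> w' j} in ennreal (exp (- \<gamma> (card T))) *
        (\<Prod>i<n. ennreal (exp (info (real (card T) * V) (part_signal c T w' i) (part_signal c T w i + z i))))) +
     (\<Sum>j<k. (\<Prod>i<n. ennreal (exp (t * ((c i (j, w j))\<^sup>2 - P)))))"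

lemma error_bound_ge_1:
  assumes w: "w \<in> message_tuples k M" and s: "s > 0" and t: "t > 0"
    and err: "\<exists>j<k. threshold_decoder n k M V \<gamma> c (channel_output n k (expurgate n P c) w z) j \<noteq> w j"
  shows "error_bound n k M P V \<gamma> s t w c z \<ge> 1"
proof -
  define y where "y = channel_output n k (expurgate n P c) w z"
  define E1 where "E1 = (\<Sum>T\<in>Pow {..<k} - {{}}. ennreal (exp (s * \<gamma> (card T))) *
        (\<Prod>i<n. ennreal (exp (- s * info (real (card T) * V) (part_signal c T w i) (part_signal c T w i + z i)))))"
  define E2 where "E2 = (\<Sum>w'\<in>message_tuples k M - {w}. let T = {j\<in>{..<k}. w j \<noteq> w' j} in ennreal (exp (- \<gamma> (card T))) *
        (\<Prod>i<n. ennreal (exp (info (real (card T) * V) (part_signal c T w' i) (part_signal c T w i + z i)))))"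
  define E3 where "E3 = (\<Sum>j<k. (\<Prod>i<n. ennreal (exp (t * ((c i (j, w j))\<^sup>2 - P)))))"
  have E: "error_bound n k M P V \<gamma> s t w c z = E1 + E2 + E3"
    by (simp add: error_bound_def E1_def E2_def E3_def)
  show ?thesis
  proof (cases "\<exists>j<k. (\<Sum>i<n. (c i (j, w j))\<^sup>2) > real n * P")
    case True
    then obtain j where j: "j < k" "(\<Sum>i<n. (c i (j, w j))\<^sup>2) > real n * P" by blast
    have "1 \<le> exp (t * ((\<Sum>i<n. (c i (j, w j))\<^sup>2) - real n * P))" using j t by simp
    also have "\<dots> = (\<Prod>i<n. exp (t * ((c i (j, w j))\<^sup>2 - P)))"
      by (simp add: exp_sum[symmetric] sum_distrib_left[symmetric] sum_subtractf)
    finally have "1 \<le> (\<Prod>i<n. ennreal (exp (t * ((c i (j, w j))\<^sup>2 - P))))"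
      by (simp add: prod_ennreal)
    also have "\<dots> \<le> E3" unfolding E3_def using j by (intro member_le_sum) auto
    finally show ?thesis unfolding E by (simp add: add_increasing)
  next
    case False
    have ex: "expurgate n P c j (w j) i = c i (j, w j)" if "j < k" for i j
    proof -
      from False that have "(\<Sum>i<n. (c i (j, w j))\<^sup>2) \<le> real n * P" by (meson not_less)
      then show ?thesis unfolding expurgate_def by (rule if_P)
    qed
    have y: "y i = part_signal c {..<k} w i + z i" if "i < n" for i
    proof -
      have "y i = (\<Sum>j<k. expurgate n P c j (w j) i) + z i"
        using that unfolding y_def channel_output_def by simp
      also have "(\<Sum>j<k. expurgate n P c j (w j) i) = part_signal c {..<k} w i"
        unfolding part_signal_def by (intro sum.cong ex) auto
      finally show ?thesis .
    qed
    have split: "part_signal c {..<k} w i = part_signal c T w i + part_signal c ({..<k} - T) w i"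
      if "T \<subseteq> {..<k}" for T i
      unfolding part_signal_def using that by (subst sum.subset_diff[OF that]) auto
    have yT: "y i - part_signal c ({..<k} - T) w i = part_signal c T w i + z i" if "T \<subseteq> {..<k}" "i < n" for T i
      using y[OF that(2)] split[OF that(1), of i] by simp
    \<comment> \<open>The decoder returns \<open>w\<close> when \<open>w\<close> is accepted and no
      other tuple is, so an error leaves only these two possibilities.\<close>
    consider (miss) "\<not> accepts n k V \<gamma> c w y"
      | (false) w' where "w' \<in> message_tuples k M - {w}" "accepts n k V \<gamma> c w' y"
    proof (cases "accepts n k V \<gamma> c w y \<and> (\<forall>w'\<in>message_tuples k M - {w}. \<not> accepts n k V \<gamma> c w' y)")
      case True
      then have "threshold_decoder n k M V \<gamma> c y j = w j" for j
        using threshold_decoder_eq[OF w, of n V \<gamma> c y j] by simp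
      with err show thesis unfolding y_def by simp
    qed (use miss false in blast)
    then show ?thesis
    proof cases
      case miss
      then obtain T where T: "T \<subseteq> {..<k}" "T \<noteq> {}" "total_info n k V c T w y \<le> \<gamma> (card T)"
        unfolding accepts_def by (auto simp: not_less)
      have "1 \<le> exp (s * \<gamma> (card T)) * exp (- s * total_info n k V c T w y)"
        using T(3) s by (simp add: exp_add[symmetric])
      also have "exp (- s * total_info n k V c T w y) =
          (\<Prod>i<n. exp (- s * info (real (card T) * V) (part_signal c T w i) (part_signal c T w i + z i)))"
        unfolding total_info_def exp_sum[OF finite_lessThan, symmetric] sum_distrib_left using yT[OF T(1)] by simp
      finally have "1 \<le> ennreal (exp (s * \<gamma> (card T))) *
        (\<Prod>i<n. ennreal (exp (- s * info (real (card T) * V) (part_signal c T w i) (part_signal c T w i + z i))))"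
        by (simp add: prod_ennreal prod_nonneg flip: ennreal_mult)
      also have "\<dots> \<le> E1" unfolding E1_def using T by (intro member_le_sum) auto
      finally show ?thesis unfolding E by (simp add: add_increasing2)
    next
      case false
      define T where "T = {j\<in>{..<k}. w j \<noteq> w' j}"
      have T: "T \<subseteq> {..<k}" "T \<noteq> {}"
        using message_tuples_diff_nonempty[OF w, of w'] false(1) by (auto simp: T_def)
      \<comment> \<open>Outside \<open>T\<close> the two tuples agree, so cancelling the codewords
        of \<open>w'\<close> there removes exactly the true interference and leaves the true signal
        of \<open>T\<close> plus noise.\<close>
      have yT': "y i - part_signal c ({..<k} - T) w' i = part_signal c T w i + z i" if "i < n" for i
      proof -
        have "part_signal c ({..<k} - T) w' i = part_signal c ({..<k} - T) w i"
          unfolding part_signal_def by (intro sum.cong) (auto simp: T_def)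
        then show ?thesis using yT[OF T(1) that] by simp
      qed
      have "\<gamma> (card T) < total_info n k V c T w' y" using false(2) T unfolding accepts_def by auto
      then have "1 \<le> exp (- \<gamma> (card T)) * exp (total_info n k V c T w' y)"
        by (simp add: exp_add[symmetric])
      also have "exp (total_info n k V c T w' y) =
          (\<Prod>i<n. exp (info (real (card T) * V) (part_signal c T w' i) (part_signal c T w i + z i)))"
        unfolding total_info_def exp_sum[OF finite_lessThan, symmetric] using yT' by simp
      finally have "1 \<le> ennreal (exp (- \<gamma> (card T))) *
        (\<Prod>i<n. ennreal (exp (info (real (card T) * V) (part_signal c T w' i) (part_signal c T w i + z i))))"
        by (simp add: prod_ennreal prod_nonneg flip: ennreal_mult)
      also have "\<dots> \<le> E2" unfolding E2_def using false(1)
        by (intro order_trans[OF _ member_le_sum[of w']]) (auto simp: T_def Let_def)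
      finally show ?thesis unfolding E by (intro add_increasing2 add_increasing) auto
    qed
  qed
qed

section \<open>Random codebooks and single-letter integrals\<close>

lemma noise_eq: "noise n = PiM {..<n} (\<lambda>_. gauss 1)"
  by (simp add: noise_def gauss_def)

lemma prob_space_noise: "prob_space (noise n)"
  unfolding noise_eq by (intro prob_space_PiM prob_space_gauss) simp

lemma measurable_noise_component:
  assumes "i < n"
  shows "(\<lambda>z. z i) \<in> borel_measurable (noise n)"
proof -
  have "(\<lambda>z. z i) \<in> noise n \<rightarrow>\<^sub>M gauss 1"
    unfolding noise_eq using assms by (intro measurable_component_singleton) simp
  then show ?thesis by (simp add: measurable_cong_sets[OF refl sets_gauss])
qed

text \<open>Time is the outer index so that the codebook, like the noise, is an
  \<open>n\<close>-fold product of one and the same measure.\<close>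

definition codebook :: "nat \<Rightarrow> nat \<Rightarrow> nat \<Rightarrow> real \<Rightarrow> (nat \<Rightarrow> nat \<times> nat \<Rightarrow> real) measure" where
  "codebook n k M V = PiM {..<n} (\<lambda>_. PiM ({..<k} \<times> {1..M}) (\<lambda>_. gauss V))"

lemma prob_space_codebook: "V > 0 \<Longrightarrow> prob_space (codebook n k M V)"
  unfolding codebook_def by (intro prob_space_PiM prob_space_gauss)

lemma borel_measurable_prod_components:
  fixes h :: "'a \<Rightarrow> 'b \<Rightarrow> ennreal"
  assumes h: "case_prod h \<in> borel_measurable (A \<Otimes>\<^sub>M B)"
  shows "(\<lambda>p. \<Prod>i<n. h (fst p i) (snd p i)) \<in> borel_measurable (PiM {..<n} (\<lambda>_. A) \<Otimes>\<^sub>M PiM {..<n} (\<lambda>_. B))"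
proof (intro borel_measurable_prod_ennreal)
  fix i assume i: "i \<in> {..<n}"
  have "(\<lambda>p. (fst p i, snd p i)) \<in> PiM {..<n} (\<lambda>_. A) \<Otimes>\<^sub>M PiM {..<n} (\<lambda>_. B) \<rightarrow>\<^sub>M A \<Otimes>\<^sub>M B"
    using i by (intro measurable_Pair measurable_compose[OF measurable_fst] measurable_compose[OF measurable_snd] measurable_component_singleton)
  from measurable_compose[OF this h]
  show "(\<lambda>p. h (fst p i) (snd p i)) \<in> borel_measurable (PiM {..<n} (\<lambda>_. A) \<Otimes>\<^sub>M PiM {..<n} (\<lambda>_. B))"
    by simp
qed

text \<open>Tonelli separates codebook and noise, after which each product measure factorises over
  time; all factors are equal, hence the power \<open>n\<close>.\<close>

lemma nn_integral_prod_components: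
  fixes h :: "'a \<Rightarrow> 'b \<Rightarrow> ennreal" and n :: nat
  assumes A: "prob_space A" and B: "prob_space B"
    and h: "case_prod h \<in> borel_measurable (A \<Otimes>\<^sub>M B)"
  shows "(\<integral>\<^sup>+p. (\<Prod>i<n. h (fst p i) (snd p i)) \<partial>(PiM {..<n} (\<lambda>_. A) \<Otimes>\<^sub>M PiM {..<n} (\<lambda>_. B))) =
    (\<integral>\<^sup>+u. (\<integral>\<^sup>+v. h u v \<partial>B) \<partial>A) ^ n"
proof -
  interpret A: prob_space A by fact
  interpret B: prob_space B by fact
  interpret PA: product_prob_space "\<lambda>_. A" "{..<n}" by (intro product_prob_spaceI A)
  interpret PB: product_prob_space "\<lambda>_. B" "{..<n}" by (intro product_prob_spaceI B)
  have "(\<integral>\<^sup>+p. (\<Prod>i<n. h (fst p i) (snd p i)) \<partial>(PiM {..<n} (\<lambda>_. A) \<Otimes>\<^sub>M PiM {..<n} (\<lambda>_. B))) =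
     (\<integral>\<^sup>+c. (\<integral>\<^sup>+z. (\<Prod>i<n. h (c i) (z i)) \<partial>PiM {..<n} (\<lambda>_. B)) \<partial>PiM {..<n} (\<lambda>_. A))"
    by (subst PB.P.nn_integral_fst[symmetric, OF borel_measurable_prod_components[OF h]]) simp
  also have "\<dots> = (\<integral>\<^sup>+c. (\<Prod>i<n. \<integral>\<^sup>+v. h (c i) v \<partial>B) \<partial>PiM {..<n} (\<lambda>_. A))"
  proof (intro nn_integral_cong PB.product_nn_integral_prod)
    fix c :: "nat \<Rightarrow> 'a" and i assume "c \<in> space (PiM {..<n} (\<lambda>_. A))" "i \<in> {..<n}"
    then have "c i \<in> space A" by (auto simp: space_PiM)
    then show "h (c i) \<in> borel_measurable B"
      using measurable_Pair2[OF h] by simp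
  qed simp
  also have "\<dots> = (\<Prod>i<n. \<integral>\<^sup>+u. (\<integral>\<^sup>+v. h u v \<partial>B) \<partial>A)"
    by (intro PA.product_nn_integral_prod B.borel_measurable_nn_integral h) simp
  finally show ?thesis by simp
qed

lemma nn_integral_weighted_sum:
  fixes f :: "'i \<Rightarrow> 'a \<Rightarrow> ennreal"
  assumes "\<And>a. a \<in> A \<Longrightarrow> f a \<in> borel_measurable N"
  shows "(\<integral>\<^sup>+p. (\<Sum>a\<in>A. b a * f a p) \<partial>N) = (\<Sum>a\<in>A. b a * (\<integral>\<^sup>+p. f a p \<partial>N))"
proof -
  have "(\<integral>\<^sup>+p. (\<Sum>a\<in>A. b a * f a p) \<partial>N) = (\<Sum>a\<in>A. (\<integral>\<^sup>+p. b a * f a p \<partial>N))"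
    using assms by (intro nn_integral_sum borel_measurable_times_ennreal borel_measurable_const)
  also have "\<dots> = (\<Sum>a\<in>A. b a * (\<integral>\<^sup>+p. f a p \<partial>N))"
    using assms by (intro sum.cong nn_integral_cmult) auto
  finally show ?thesis .
qed

text \<open>A wrong tuple keeps only its threshold factor, since its likelihood ratio has mean 1.
  The last term is \<open>k\<close> times the Chernoff bound for the event that the sum of
  \<open>n\<close> squared \<open>N(0, V)\<close> variables exceeds \<open>n * P\<close>.\<close>

lemma nn_integral_error_bound:
  assumes V: "V > 0" and s: "0 < s" "s < 1" and t: "2 * t * V < 1" and w: "w \<in> message_tuples k M"
  shows "(\<integral>\<^sup>+p. error_bound n k M P V \<gamma> s t w (fst p) (snd p) \<partial>(codebook n k M V \<Otimes>\<^sub>M noise n)) \<le>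
     (\<Sum>T\<in>Pow {..<k} - {{}}. ennreal (exp (s * \<gamma> (card T)) *
        exp (- (s / 2) * (1 - s / (1 - s\<^sup>2)) * ln (1 + real (card T) * V)) ^ n)) +
     (\<Sum>w'\<in>message_tuples k M - {w}. ennreal (exp (- \<gamma> (card {j\<in>{..<k}. w j \<noteq> w' j})))) +
     real k * (exp (- t * P) / sqrt (1 - 2 * t * V)) ^ n"
proof -
  let ?J = "{..<k} \<times> {1..M}"
  let ?A = "PiM ?J (\<lambda>_. gauss V)"
  let ?N = "codebook n k M V \<Otimes>\<^sub>M noise n"
  have N: "?N = PiM {..<n} (\<lambda>_. ?A) \<Otimes>\<^sub>M PiM {..<n} (\<lambda>_. gauss 1)"
    by (simp add: codebook_def noise_eq)
  have A: "prob_space ?A" by (intro prob_space_PiM prob_space_gauss V)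
  interpret G1: prob_space "gauss 1" by (rule prob_space_gauss) simp
  note G1 = G1.prob_space_axioms
  have wj: "w j \<in> {1..M}" if "j < k" for j using PiE_mem[OF w[unfolded message_tuples_def], of j] that by simp
  have meas: "(\<lambda>u. \<Sum>j\<in>T. u (j, w' j)) \<in> borel_measurable ?A"
    if "T \<subseteq> {..<k}" "w' \<in> message_tuples k M" for T w'
  proof (intro borel_measurable_sum)
    fix j assume "j \<in> T"
    with that have "(j, w' j) \<in> ?J" by (auto simp: message_tuples_def)
    then show "(\<lambda>u. u (j, w' j)) \<in> borel_measurable ?A" by measurable
  qed
  \<comment> \<open>The symbols sent by the users in \<open>T\<close> form a set of coordinates of
    the codebook column, of the same size as \<open>T\<close>; in this form the lemmas on sums of
    coordinates apply.\<close>
  have reindex: "(\<Sum>j\<in>T. u (j, w' j)) = (\<Sum>a\<in>(\<lambda>j. (j, w' j)) ` T. u a)" for u :: "nat \<times> nat \<Rightarrow> real" and T w'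
    by (subst sum.reindex) (auto simp: inj_on_def)
  have card: "card ((\<lambda>j. (j, w' j)) ` T) = card T" for T and w' :: "nat \<Rightarrow> nat"
    by (rule card_image) (auto simp: inj_on_def)

  \<comment> \<open>Single-letter factors of the three kinds of weight; \<open>h3\<close> carries a
    dummy noise argument so that all three fit the same factorisation lemma.\<close>
  define h1 where "h1 T u v = ennreal (exp (- s * info (real (card T) * V) (\<Sum>j\<in>T. u (j, w j)) ((\<Sum>j\<in>T. u (j, w j)) + v)))"
    for T and u :: "nat \<times> nat \<Rightarrow> real" and v
  define h2 where "h2 w' T u v = ennreal (exp (info (real (card T) * V) (\<Sum>j\<in>T. u (j, w' j)) ((\<Sum>j\<in>T. u (j, w j)) + v)))"
    for w' T and u :: "nat \<times> nat \<Rightarrow> real" and v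
  define h3 where "h3 j u v = ennreal (exp (t * ((u (j, w j))\<^sup>2 - P)))"
    for j and u :: "nat \<times> nat \<Rightarrow> real" and v :: real

  have h1: "case_prod (h1 T) \<in> borel_measurable (?A \<Otimes>\<^sub>M gauss 1)" if "T \<subseteq> {..<k}" for T
  proof -
    note [measurable] = meas[OF that w]
    show ?thesis unfolding h1_def by measurable
  qed
  have h2: "case_prod (h2 w' T) \<in> borel_measurable (?A \<Otimes>\<^sub>M gauss 1)"
    if "T \<subseteq> {..<k}" "w' \<in> message_tuples k M" for T w'
  proof -
    note [measurable] = meas[OF that(1) w] meas[OF that]
    show ?thesis unfolding h2_def by measurable
  qed
  have h3: "case_prod (h3 j) \<in> borel_measurable (?A \<Otimes>\<^sub>M gauss 1)" if "j < k" for j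
  proof -
    have "(j, w j) \<in> ?J" using wj[OF that] that by auto
    then have [measurable]: "(\<lambda>u. u (j, w j)) \<in> borel_measurable ?A" by measurable
    show ?thesis unfolding h3_def by measurable
  qed

  have i1: "(\<integral>\<^sup>+u. (\<integral>\<^sup>+v. h1 T u v \<partial>gauss 1) \<partial>?A) \<le>
      ennreal (exp (- (s / 2) * (1 - s / (1 - s\<^sup>2)) * ln (1 + real (card T) * V)))"
    if T: "T \<subseteq> {..<k}" "T \<noteq> {}" for T
  proof -
    have Q: "real (card T) * V > 0" using T V finite_subset[OF T(1)] by (simp add: card_gt_0_iff)
    have m: "(\<lambda>x. \<integral>\<^sup>+v. ennreal (exp (- s * info (real (card T) * V) x (x + v))) \<partial>gauss 1) \<in> borel_measurable borel"
      by measurable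
    have "(\<integral>\<^sup>+u. (\<integral>\<^sup>+v. h1 T u v \<partial>gauss 1) \<partial>?A) =
      (\<integral>\<^sup>+x. (\<integral>\<^sup>+v. ennreal (exp (- s * info (real (card T) * V) x (x + v))) \<partial>gauss 1)
        \<partial>gauss (real (card ((\<lambda>j. (j, w j)) ` T)) * V))"
      unfolding h1_def reindex using T wj
      by (intro nn_integral_iid_sum_subset[OF V _ _ _ m]) auto
    then show ?thesis unfolding card using nn_integral_exp_neg_info[OF Q s] by simp
  qed
  have i2: "(\<integral>\<^sup>+u. (\<integral>\<^sup>+v. h2 w' T u v \<partial>gauss 1) \<partial>?A) = 1"
    if w': "w' \<in> message_tuples k M" "T = {j\<in>{..<k}. w j \<noteq> w' j}" "T \<noteq> {}" for w' T
  proof -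
    have Q: "real (card T) * V > 0" using that V by (simp add: card_gt_0_iff)
    interpret GQ: prob_space "gauss (real (card T) * V)" by (rule prob_space_gauss[OF Q])
    interpret F: pair_sigma_finite "gauss 1" "gauss (real (card T) * V)" ..
    have m: "(\<lambda>(x, x'). \<integral>\<^sup>+v. ennreal (exp (info (real (card T) * V) x' (x + v))) \<partial>gauss 1)
        \<in> borel_measurable (borel \<Otimes>\<^sub>M borel)"
      by measurable
    have "(\<integral>\<^sup>+u. (\<integral>\<^sup>+v. h2 w' T u v \<partial>gauss 1) \<partial>?A) =
      (\<integral>\<^sup>+x. (\<integral>\<^sup>+x'. (\<integral>\<^sup>+v. ennreal (exp (info (real (card T) * V) x' (x + v))) \<partial>gauss 1)
        \<partial>gauss (real (card ((\<lambda>j. (j, w' j)) ` T)) * V)) \<partial>gauss (real (card ((\<lambda>j. (j, w j)) ` T)) * V))"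
      unfolding h2_def reindex using w' w
      by (intro nn_integral_iid_two_sums[OF V _ _ _ _ _ _ m]) (auto simp: message_tuples_def)
    \<comment> \<open>On \<open>T\<close> the two tuples differ everywhere, so the wrong signal is
      independent of the true one. Integrating it before the noise gives 1 for every output
      \<open>x + v\<close>, and then only total masses remain.\<close>
    also have "\<dots> = (\<integral>\<^sup>+x. (\<integral>\<^sup>+v. (\<integral>\<^sup>+x'. ennreal (exp (info (real (card T) * V) x' (x + v)))
        \<partial>gauss (real (card T) * V)) \<partial>gauss 1) \<partial>gauss (real (card T) * V))"
      unfolding card by (intro nn_integral_cong F.Fubini') measurable
    also have "\<dots> = 1"
      unfolding nn_integral_exp_info[OF Q] using G1.emeasure_space_1 GQ.emeasure_space_1 by simp
    finally show ?thesis .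
  qed
  have i3: "(\<integral>\<^sup>+u. (\<integral>\<^sup>+v. h3 j u v \<partial>gauss 1) \<partial>?A) = ennreal (exp (- t * P) / sqrt (1 - 2 * t * V))"
    if j: "j < k" for j
  proof -
    have "(\<integral>\<^sup>+u. (\<integral>\<^sup>+v. h3 j u v \<partial>gauss 1) \<partial>?A) =
        (\<integral>\<^sup>+u. ennreal (exp (t * ((\<Sum>a\<in>{(j, w j)}. u a)\<^sup>2 - P))) \<partial>?A)"
      unfolding h3_def using G1.emeasure_space_1 by simp
    also have "\<dots> = (\<integral>\<^sup>+x. ennreal (exp (t * (x\<^sup>2 - P))) \<partial>gauss (real (card {(j, w j)}) * V))"
      using wj[OF j] j by (intro nn_integral_iid_sum_subset[OF V]) auto
    also have "\<dots> = (\<integral>\<^sup>+x. ennreal (exp (- t * P)) * ennreal (exp (0 * x - (- t) * x\<^sup>2)) \<partial>gauss V)"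
      by (auto intro!: nn_integral_cong simp: algebra_simps simp flip: ennreal_mult exp_add)
    also have "\<dots> = ennreal (exp (- t * P)) * ennreal (1 / sqrt (1 - 2 * t * V))"
      using V t by (subst nn_integral_cmult, simp, subst nn_integral_gauss_exp) simp_all
    also have "\<dots> = ennreal (exp (- t * P) / sqrt (1 - 2 * t * V))"
      using t by (simp flip: ennreal_mult)
    finally show ?thesis .
  qed

  have m1: "(\<lambda>p. \<Prod>i<n. h1 T (fst p i) (snd p i)) \<in> borel_measurable ?N" if "T \<in> Pow {..<k} - {{}}" for T
    unfolding N using that by (intro borel_measurable_prod_components h1) auto
  have m2: "(\<lambda>p. \<Prod>i<n. h2 w' {j\<in>{..<k}. w j \<noteq> w' j} (fst p i) (snd p i)) \<in> borel_measurable ?N"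
    if "w' \<in> message_tuples k M - {w}" for w'
    unfolding N using that by (intro borel_measurable_prod_components h2) auto
  have m3: "(\<lambda>p. \<Prod>i<n. h3 j (fst p i) (snd p i)) \<in> borel_measurable ?N" if "j \<in> {..<k}" for j
    unfolding N using that by (intro borel_measurable_prod_components h3) auto

  have "(\<integral>\<^sup>+p. error_bound n k M P V \<gamma> s t w (fst p) (snd p) \<partial>?N) =
      (\<integral>\<^sup>+p. (\<Sum>T\<in>Pow {..<k} - {{}}. ennreal (exp (s * \<gamma> (card T))) * (\<Prod>i<n. h1 T (fst p i) (snd p i))) +
       (\<Sum>w'\<in>message_tuples k M - {w}. ennreal (exp (- \<gamma> (card {j\<in>{..<k}. w j \<noteq> w' j}))) *
          (\<Prod>i<n. h2 w' {j\<in>{..<k}. w j \<noteq> w' j} (fst p i) (snd p i))) +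
       (\<Sum>j<k. \<Prod>i<n. h3 j (fst p i) (snd p i)) \<partial>?N)"
    unfolding error_bound_def h1_def h2_def h3_def part_signal_def Let_def ..
  also have "\<dots> = (\<Sum>T\<in>Pow {..<k} - {{}}. ennreal (exp (s * \<gamma> (card T))) * (\<integral>\<^sup>+p. (\<Prod>i<n. h1 T (fst p i) (snd p i)) \<partial>?N)) +
       (\<Sum>w'\<in>message_tuples k M - {w}. ennreal (exp (- \<gamma> (card {j\<in>{..<k}. w j \<noteq> w' j}))) *
          (\<integral>\<^sup>+p. (\<Prod>i<n. h2 w' {j\<in>{..<k}. w j \<noteq> w' j} (fst p i) (snd p i)) \<partial>?N)) +
       (\<Sum>j<k. \<integral>\<^sup>+p. (\<Prod>i<n. h3 j (fst p i) (snd p i)) \<partial>?N)"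
  proof -
    have s1: "(\<lambda>p. \<Sum>T\<in>Pow {..<k} - {{}}. ennreal (exp (s * \<gamma> (card T))) * (\<Prod>i<n. h1 T (fst p i) (snd p i))) \<in> borel_measurable ?N"
      by (intro borel_measurable_sum borel_measurable_times_ennreal borel_measurable_const m1)
    have s2: "(\<lambda>p. \<Sum>w'\<in>message_tuples k M - {w}. ennreal (exp (- \<gamma> (card {j\<in>{..<k}. w j \<noteq> w' j}))) *
          (\<Prod>i<n. h2 w' {j\<in>{..<k}. w j \<noteq> w' j} (fst p i) (snd p i))) \<in> borel_measurable ?N"
      by (intro borel_measurable_sum borel_measurable_times_ennreal borel_measurable_const m2)
    have s3: "(\<lambda>p. \<Sum>j<k. \<Prod>i<n. h3 j (fst p i) (snd p i)) \<in> borel_measurable ?N"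
      by (intro borel_measurable_sum m3)
    show ?thesis
      unfolding nn_integral_add[OF borel_measurable_add[OF s1 s2] s3] nn_integral_add[OF s1 s2]
      by (intro arg_cong2[where f = "(+)"] nn_integral_weighted_sum nn_integral_sum m1 m2 m3)
  qed
  also have "\<dots> \<le> (\<Sum>T\<in>Pow {..<k} - {{}}. ennreal (exp (s * \<gamma> (card T)) *
        exp (- (s / 2) * (1 - s / (1 - s\<^sup>2)) * ln (1 + real (card T) * V)) ^ n)) +
     (\<Sum>w'\<in>message_tuples k M - {w}. ennreal (exp (- \<gamma> (card {j\<in>{..<k}. w j \<noteq> w' j})))) +
     real k * (exp (- t * P) / sqrt (1 - 2 * t * V)) ^ n"
  proof (intro add_mono sum_mono)
    fix T assume T: "T \<in> Pow {..<k} - {{}}"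
    have "(\<integral>\<^sup>+p. (\<Prod>i<n. h1 T (fst p i) (snd p i)) \<partial>?N) = (\<integral>\<^sup>+u. (\<integral>\<^sup>+v. h1 T u v \<partial>gauss 1) \<partial>?A) ^ n"
      unfolding N using T by (intro nn_integral_prod_components A G1 h1) auto
    also have "\<dots> \<le> ennreal (exp (- (s / 2) * (1 - s / (1 - s\<^sup>2)) * ln (1 + real (card T) * V))) ^ n"
      using T by (intro power_mono i1) auto
    finally show "ennreal (exp (s * \<gamma> (card T))) * (\<integral>\<^sup>+p. (\<Prod>i<n. h1 T (fst p i) (snd p i)) \<partial>?N) \<le>
        ennreal (exp (s * \<gamma> (card T)) * exp (- (s / 2) * (1 - s / (1 - s\<^sup>2)) * ln (1 + real (card T) * V)) ^ n)"
      by (simp add: ennreal_mult ennreal_power mult_left_mono)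
  next
    fix w' assume w': "w' \<in> message_tuples k M - {w}"
    then have "{j\<in>{..<k}. w j \<noteq> w' j} \<noteq> {}"
      using message_tuples_diff_nonempty[OF w, of w'] by (metis DiffE insertI1)
    then have i: "(\<integral>\<^sup>+u. (\<integral>\<^sup>+v. h2 w' {j\<in>{..<k}. w j \<noteq> w' j} u v \<partial>gauss 1) \<partial>?A) = 1"
      using w' by (intro i2) auto
    have m: "case_prod (h2 w' {j\<in>{..<k}. w j \<noteq> w' j}) \<in> borel_measurable (?A \<Otimes>\<^sub>M gauss 1)"
      using w' by (intro h2) auto
    have "(\<integral>\<^sup>+p. (\<Prod>i<n. h2 w' {j\<in>{..<k}. w j \<noteq> w' j} (fst p i) (snd p i)) \<partial>?N) = 1 ^ n"
      unfolding N nn_integral_prod_components[OF A G1 m] i ..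
    then show "ennreal (exp (- \<gamma> (card {j\<in>{..<k}. w j \<noteq> w' j}))) *
        (\<integral>\<^sup>+p. (\<Prod>i<n. h2 w' {j\<in>{..<k}. w j \<noteq> w' j} (fst p i) (snd p i)) \<partial>?N)
        \<le> ennreal (exp (- \<gamma> (card {j\<in>{..<k}. w j \<noteq> w' j})))"
      by simp
  next
    have "(\<Sum>j<k. \<integral>\<^sup>+p. (\<Prod>i<n. h3 j (fst p i) (snd p i)) \<partial>?N) =
        (\<Sum>j<k. ennreal ((exp (- t * P) / sqrt (1 - 2 * t * V)) ^ n))"
    proof (intro sum.cong refl)
      fix j assume "j \<in> {..<k}"
      then have j: "j < k" by simp
      show "(\<integral>\<^sup>+p. (\<Prod>i<n. h3 j (fst p i) (snd p i)) \<partial>?N) = ennreal ((exp (- t * P) / sqrt (1 - 2 * t * V)) ^ n)"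
        unfolding N nn_integral_prod_components[OF A G1 h3[OF j]] i3[OF j] using t by (simp add: ennreal_power)
    qed
    also have "\<dots> = ennreal (real k * (exp (- t * P) / sqrt (1 - 2 * t * V)) ^ n)"
      using t by (subst sum_ennreal) simp_all
    finally show "(\<Sum>j<k. \<integral>\<^sup>+p. (\<Prod>i<n. h3 j (fst p i) (snd p i)) \<partial>?N) \<le>
        ennreal (real k * (exp (- t * P) / sqrt (1 - 2 * t * V)) ^ n)" by simp
  qed
  finally show ?thesis .
qed

section \<open>Counting sets of users and wrong tuples\<close>

lemma sum_over_nonempty_subsets:
  fixes f :: "nat \<Rightarrow> real"
  shows "(\<Sum>T\<in>Pow {..<k} - {{}}. f (card T)) = (\<Sum>d=1..k. real (k choose d) * f d)"
proof -
  have "(\<Sum>T\<in>Pow {..<k} - {{}}. f (card T)) =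
      (\<Sum>d=1..k. \<Sum>T\<in>{T \<in> Pow {..<k} - {{}}. card T = d}. f (card T))"
  proof (rule sum.group[symmetric])
    show "card ` (Pow {..<k} - {{}}) \<subseteq> {1..k}"
    proof
      fix d assume "d \<in> card ` (Pow {..<k} - {{}})"
      then obtain T where T: "T \<subseteq> {..<k}" "T \<noteq> {}" "d = card T" by auto
      have "finite T" using T(1) finite_subset by blast
      then show "d \<in> {1..k}" using T card_mono[of "{..<k}" T] by (simp add: Suc_le_eq card_gt_0_iff)
    qed
  qed auto
  also have "\<dots> = (\<Sum>d=1..k. real (k choose d) * f d)"
  proof (intro sum.cong refl)
    fix d assume d: "d \<in> {1..k}"
    have "{T \<in> Pow {..<k} - {{}}. card T = d} = {T. T \<subseteq> {..<k} \<and> card T = d}"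
      using d by auto
    then have "card {T \<in> Pow {..<k} - {{}}. card T = d} = k choose d"
      using n_subsets[of "{..<k}" d] by simp
    then show "(\<Sum>T\<in>{T \<in> Pow {..<k} - {{}}. card T = d}. f (card T)) = real (k choose d) * f d"
      by simp
  qed
  finally show ?thesis .
qed

text \<open>A tuple that differs from \<open>w\<close> exactly on \<open>T\<close> is determined by
  its restriction to \<open>T\<close>, since it equals \<open>w\<close> on all other users.\<close>

lemma card_message_tuples_diff:
  assumes "w \<in> message_tuples k M" "T \<subseteq> {..<k}"
  shows "card {w' \<in> message_tuples k M. {j\<in>{..<k}. w j \<noteq> w' j} = T} \<le> M ^ card T"
proof -
  let ?S = "{w' \<in> message_tuples k M. {j\<in>{..<k}. w j \<noteq> w' j} = T}"
  have "inj_on (\<lambda>w'. restrict w' T) ?S"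
  proof (rule inj_onI)
    fix x y assume x: "x \<in> ?S" and y: "y \<in> ?S" and e: "restrict x T = restrict y T"
    have "x j = y j" if "j \<in> {..<k}" for j
    proof (cases "j \<in> T")
      case True
      then show ?thesis using e by (metis restrict_apply')
    next
      case False
      then have "w j = x j" "w j = y j" using x y that by auto
      then show ?thesis by simp
    qed
    moreover have "x \<in> PiE {..<k} (\<lambda>_. {1..M})" "y \<in> PiE {..<k} (\<lambda>_. {1..M})"
      using x y by (auto simp: message_tuples_def)
    ultimately show "x = y" by (intro PiE_ext)
  qed
  moreover have "(\<lambda>w'. restrict w' T) ` ?S \<subseteq> PiE T (\<lambda>_. {1..M})"
    using assms(2) by (auto simp: message_tuples_def)
  moreover have fT: "finite T" using assms(2) finite_subset by blast
  ultimately have "card ?S \<le> card (PiE T (\<lambda>_. {1..M}))"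
    by (intro card_inj_on_le) (auto intro: finite_PiE)
  then show ?thesis using fT by (simp add: card_PiE)
qed

lemma sum_over_wrong_tuples:
  fixes f :: "nat \<Rightarrow> real"
  assumes w: "w \<in> message_tuples k M" and f: "\<And>d. f d \<ge> 0"
  shows "(\<Sum>w'\<in>message_tuples k M - {w}. f (card {j\<in>{..<k}. w j \<noteq> w' j}))
    \<le> (\<Sum>T\<in>Pow {..<k} - {{}}. real M ^ card T * f (card T))"
proof -
  let ?T = "\<lambda>w'. {j\<in>{..<k}. w j \<noteq> w' j}"
  have "(\<Sum>w'\<in>message_tuples k M - {w}. f (card (?T w'))) =
      (\<Sum>T\<in>Pow {..<k} - {{}}. \<Sum>w'\<in>{w' \<in> message_tuples k M - {w}. ?T w' = T}. f (card (?T w')))"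
  proof (rule sum.group[symmetric])
    have "?T w' \<in> Pow {..<k} - {{}}" if "w' \<in> message_tuples k M - {w}" for w'
      using message_tuples_diff_nonempty[OF w, of w'] that by blast
    then show "?T ` (message_tuples k M - {w}) \<subseteq> Pow {..<k} - {{}}" by blast
  qed auto
  also have "\<dots> \<le> (\<Sum>T\<in>Pow {..<k} - {{}}. real M ^ card T * f (card T))"
  proof (rule sum_mono)
    fix T assume T: "T \<in> Pow {..<k} - {{}}"
    let ?S = "{w' \<in> message_tuples k M - {w}. ?T w' = T}"
    have "card ?S \<le> card {w' \<in> message_tuples k M. ?T w' = T}"
      by (rule card_mono[OF finite_subset[OF _ finite_message_tuples]]) blast+
    also have "\<dots> \<le> M ^ card T" using T by (intro card_message_tuples_diff[OF w]) simp
    finally have "card ?S \<le> M ^ card T" .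
    from of_nat_mono[OF this, where 'a = real] have "real (card ?S) \<le> real M ^ card T"
      by (simp only: of_nat_power)
    moreover have "(\<Sum>w'\<in>?S. f (card (?T w'))) = (\<Sum>w'\<in>?S. f (card T))"
      by (intro sum.cong) auto
    ultimately show "(\<Sum>w'\<in>?S. f (card (?T w'))) \<le> real M ^ card T * f (card T)"
      using f by (simp add: mult_right_mono)
  qed
  finally show ?thesis .
qed

text \<open>Markov's inequality in the form of a majorant. On a set outside \<open>sets N\<close>
  the value of \<open>measure\<close> is 0, so the bound also covers error events whose
  measurability has not been established.\<close>

lemma measure_le_nn_integral:
  assumes "prob_space N" and "\<And>z. z \<in> A \<Longrightarrow> 1 \<le> f z"
  shows "ennreal (measure N A) \<le> (\<integral>\<^sup>+z. f z \<partial>N)"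
proof (cases "A \<in> sets N")
  case True
  interpret prob_space N by fact
  have "ennreal (measure N A) = (\<integral>\<^sup>+z. indicator A z \<partial>N)"
    using True by (simp add: emeasure_eq_measure)
  also have "\<dots> \<le> (\<integral>\<^sup>+z. f z \<partial>N)"
    using assms(2) by (intro nn_integral_mono) (auto split: split_indicator)
  finally show ?thesis .
qed (simp add: measure_notin_sets)

lemma measurable_error_bound:
  assumes w: "w \<in> message_tuples k M"
  shows "(\<lambda>p. error_bound n k M P V \<gamma> s t w (fst p) (snd p)) \<in> borel_measurable (codebook n k M V \<Otimes>\<^sub>M noise n)"
proof -
  have c: "(\<lambda>p. fst p i (j, w' j)) \<in> borel_measurable (codebook n k M V \<Otimes>\<^sub>M noise n)"
    if "i < n" "j < k" "w' \<in> message_tuples k M" for i j w'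
  proof -
    have "(j, w' j) \<in> {..<k} \<times> {1..M}"
      using PiE_mem[OF that(3)[unfolded message_tuples_def], of j] that(2) by simp
    then have u: "(\<lambda>u. u (j, w' j)) \<in> borel_measurable (PiM ({..<k} \<times> {1..M}) (\<lambda>_. gauss V))"
      by measurable
    have "(\<lambda>p. fst p i) \<in> codebook n k M V \<Otimes>\<^sub>M noise n \<rightarrow>\<^sub>M PiM ({..<k} \<times> {1..M}) (\<lambda>_. gauss V)"
      unfolding codebook_def using that(1)
      by (intro measurable_compose[OF measurable_fst] measurable_component_singleton) simp
    from measurable_compose[OF this u] show ?thesis .
  qed
  have z: "(\<lambda>p. snd p i) \<in> borel_measurable (codebook n k M V \<Otimes>\<^sub>M noise n)" if "i < n" for i
  proof -
    have "(\<lambda>z. z i) \<in> borel_measurable (noise n)" using that by (rule measurable_noise_component)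
    then show ?thesis by (rule measurable_compose[OF measurable_snd])
  qed
  have x: "(\<lambda>p. part_signal (fst p) T w' i) \<in> borel_measurable (codebook n k M V \<Otimes>\<^sub>M noise n)"
    if "i < n" "T \<subseteq> {..<k}" "w' \<in> message_tuples k M" for i T w'
    unfolding part_signal_def using that by (intro borel_measurable_sum c) auto
  show ?thesis
    unfolding error_bound_def Let_def
    by (intro borel_measurable_add borel_measurable_sum borel_measurable_times_ennreal borel_measurable_const
        borel_measurable_prod_ennreal measurable_compose[OF _ measurable_ennreal]
        measurable_compose[OF _ borel_measurable_exp] borel_measurable_times borel_measurable_info borel_measurable_diff borel_measurable_power x z c w)
      auto
qed

text \<open>The mean over the random codebook of the error weights, summed over all message tuples,
  is below \<open>M ^ k * \<delta>\<close>, so some fixed codebook stays below this for all tuples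
  together. In the hypothesis, the sum over \<open>d\<close> collects missed and false acceptances
  by the size of the set of users, and the last term the power violations.\<close>

theorem random_coding_bound:
  fixes n k M :: nat and P V s t \<delta> :: real and \<gamma> :: "nat \<Rightarrow> real"
  assumes V: "V > 0" and s: "0 < s" "s < 1" and t: "0 < t" "2 * t * V < 1" and P: "P \<ge> 0" and M: "M \<ge> 1"
    and \<delta>: "(\<Sum>d=1..k. real (k choose d) * (exp (s * \<gamma> d) *
        exp (- (s / 2) * (1 - s / (1 - s\<^sup>2)) * ln (1 + real d * V)) ^ n + real M ^ d * exp (- \<gamma> d))) +
      real k * (exp (- t * P) / sqrt (1 - 2 * t * V)) ^ n < \<delta>"
  shows "\<exists>cw D. valid_code P n k M cw D \<and> avg_error n k M cw D \<le> \<delta>"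
proof -
  let ?C = "codebook n k M V" and ?W = "message_tuples k M"
  let ?E = "\<lambda>w c z. error_bound n k M P V \<gamma> s t w c z"
  interpret C: prob_space ?C by (rule prob_space_codebook[OF V])
  interpret Z: prob_space "noise n" by (rule prob_space_noise)
  define a where "a d = exp (s * \<gamma> d) * exp (- (s / 2) * (1 - s / (1 - s\<^sup>2)) * ln (1 + real d * V)) ^ n" for d
  define q where "q = real k * (exp (- t * P) / sqrt (1 - 2 * t * V)) ^ n"
  define R where "R = (\<Sum>d=1..k. real (k choose d) * (a d + real M ^ d * exp (- \<gamma> d))) + q"
  have a0: "a d \<ge> 0" for d by (simp add: a_def)
  have q0: "q \<ge> 0" using t by (simp add: q_def)
  have R: "0 \<le> R" "R < \<delta>" using \<delta> a0 q0 by (auto simp: R_def a_def q_def intro!: add_nonneg_nonneg sum_nonneg)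
  have int: "(\<integral>\<^sup>+c. (\<integral>\<^sup>+z. ?E w c z \<partial>noise n) \<partial>?C) \<le> ennreal R" if w: "w \<in> ?W" for w
  proof -
    have "(\<integral>\<^sup>+c. (\<integral>\<^sup>+z. ?E w c z \<partial>noise n) \<partial>?C) = (\<integral>\<^sup>+p. ?E w (fst p) (snd p) \<partial>(?C \<Otimes>\<^sub>M noise n))"
      by (subst Z.nn_integral_fst[symmetric, OF measurable_error_bound[OF w]]) simp
    also have "\<dots> \<le> (\<Sum>T\<in>Pow {..<k} - {{}}. ennreal (a (card T))) +
       (\<Sum>w'\<in>?W - {w}. ennreal (exp (- \<gamma> (card {j\<in>{..<k}. w j \<noteq> w' j})))) + ennreal q"
      unfolding a_def q_def by (rule nn_integral_error_bound[OF V s t(2) w])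
    also have "\<dots> = ennreal ((\<Sum>T\<in>Pow {..<k} - {{}}. a (card T)) +
       (\<Sum>w'\<in>?W - {w}. exp (- \<gamma> (card {j\<in>{..<k}. w j \<noteq> w' j}))) + q)"
      using a0 q0 by (simp add: sum_ennreal ennreal_plus[symmetric] sum_nonneg del: ennreal_plus)
    also have "\<dots> \<le> ennreal R"
    proof (rule ennreal_leI)
      have "(\<Sum>w'\<in>?W - {w}. exp (- \<gamma> (card {j\<in>{..<k}. w j \<noteq> w' j}))) \<le>
        (\<Sum>T\<in>Pow {..<k} - {{}}. real M ^ card T * exp (- \<gamma> (card T)))"
        by (rule sum_over_wrong_tuples[OF w]) simp
      then show "(\<Sum>T\<in>Pow {..<k} - {{}}. a (card T)) +
         (\<Sum>w'\<in>?W - {w}. exp (- \<gamma> (card {j\<in>{..<k}. w j \<noteq> w' j}))) + q \<le> R"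
        unfolding R_def sum_over_nonempty_subsets[symmetric] by (simp add: sum.distrib)
    qed
    finally show ?thesis .
  qed
  have meas: "(\<lambda>c. \<integral>\<^sup>+z. ?E w c z \<partial>noise n) \<in> borel_measurable ?C" if "w \<in> ?W" for w
    using measurable_error_bound[OF that, of n P V \<gamma> s t]
    by (intro Z.borel_measurable_nn_integral) (simp add: split_beta')
  have "(\<integral>\<^sup>+c. (\<Sum>w\<in>?W. \<integral>\<^sup>+z. ?E w c z \<partial>noise n) \<partial>?C) = (\<Sum>w\<in>?W. \<integral>\<^sup>+c. (\<integral>\<^sup>+z. ?E w c z \<partial>noise n) \<partial>?C)"
    by (intro nn_integral_sum meas)
  also have "\<dots> \<le> (\<Sum>w\<in>?W. ennreal R)" by (intro sum_mono int)
  also have "\<dots> = ennreal (real M ^ k * R)"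
    using R by (subst sum_ennreal) simp_all
  \<comment> \<open>The strict inequality is what yields a codebook: if every \<open>c\<close>
    reached the bound, so would the mean over the probability measure \<open>?C\<close>.\<close>
  also have "\<dots> < ennreal (real M ^ k * \<delta>)"
    using R M by (intro ennreal_lessI) auto
  finally have lt: "(\<integral>\<^sup>+c. (\<Sum>w\<in>?W. \<integral>\<^sup>+z. ?E w c z \<partial>noise n) \<partial>?C) < ennreal (real M ^ k * \<delta>)" .
  have "\<exists>c. (\<Sum>w\<in>?W. \<integral>\<^sup>+z. ?E w c z \<partial>noise n) < ennreal (real M ^ k * \<delta>)"
  proof (rule ccontr)
    assume "\<not> ?thesis"
    then have "(\<integral>\<^sup>+c. ennreal (real M ^ k * \<delta>) \<partial>?C) \<le> (\<integral>\<^sup>+c. (\<Sum>w\<in>?W. \<integral>\<^sup>+z. ?E w c z \<partial>noise n) \<partial>?C)"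
      by (intro nn_integral_mono) (simp add: not_less)
    with lt show False by (simp add: C.emeasure_space_1)
  qed
  then obtain c where c: "(\<Sum>w\<in>?W. \<integral>\<^sup>+z. ?E w c z \<partial>noise n) < ennreal (real M ^ k * \<delta>)" ..
  let ?cw = "expurgate n P c" and ?D = "threshold_decoder n k M V \<gamma> c"
  define err where "err w = measure (noise n) {z \<in> space (noise n). \<exists>j<k. ?D (channel_output n k ?cw w z) j \<noteq> w j}" for w
  have "ennreal (\<Sum>w\<in>?W. err w) = (\<Sum>w\<in>?W. ennreal (err w))"
    by (subst sum_ennreal) (simp_all add: err_def)
  also have "\<dots> \<le> (\<Sum>w\<in>?W. \<integral>\<^sup>+z. ?E w c z \<partial>noise n)"
    unfolding err_def
    by (intro sum_mono measure_le_nn_integral Z.prob_space_axioms error_bound_ge_1[OF _ s(1) t(1)]) auto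
  also note c
  finally have "(\<Sum>w\<in>?W. err w) < real M ^ k * \<delta>"
    using R M by (subst (asm) ennreal_less_iff) (auto simp: err_def sum_nonneg)
  then have "avg_error n k M ?cw ?D \<le> \<delta>"
    unfolding avg_error_def err_def message_tuples_def[symmetric] using M by (simp add: field_simps)
  with valid_code_expurgate[OF P] show ?thesis by blast
qed

section \<open>Asymptotics of the random coding bound\<close>

text \<open>Concavity between 1 and \<open>1 + x\<close>. It is used with
  \<open>\<theta> = d / k\<close> to compare the rate of \<open>d\<close> users with their share of
  the total, and with \<open>\<theta> = 1 - \<epsilon> / 4\<close> to price the reduced codeword
  power.\<close>

lemma ln_one_plus_concave:
  fixes x \<theta> :: real
  assumes "x \<ge> 0" "0 \<le> \<theta>" "\<theta> \<le> 1"
  shows "\<theta> * ln (1 + x) \<le> ln (1 + \<theta> * x)"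
  using concave_onD[OF ln_concave assms(2,3), of 1 "1 + x"] assms(1) by (simp add: algebra_simps)

lemma ln_one_plus_pos: "P > 0 \<Longrightarrow> d \<ge> 1 \<Longrightarrow> ln (1 + real d * P) \<ge> ln (1 + P) \<and> ln (1 + P) > 0"
proof (intro conjI)
  assume "P > 0" "d \<ge> 1"
  then have "1 * P \<le> real d * P" by (intro mult_right_mono) auto
  then show "ln (1 + P) \<le> ln (1 + real d * P)" using \<open>P > 0\<close> by (intro ln_mono) auto
qed simp

text \<open>Rounding up costs a factor of at most 2 once \<open>exp v \<ge> 1\<close>; one such
  factor per user is the origin of the powers \<open>2 ^ d\<close> in the later estimates.\<close>

lemma num_messages_bounds:
  "1 \<le> num_messages v" "exp v \<le> real (num_messages v)"
  "v \<ge> 0 \<Longrightarrow> real (num_messages v) \<le> 2 * exp v"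
proof -
  have c: "real (num_messages v) = real_of_int \<lceil>exp v\<rceil>"
    unfolding num_messages_def by (simp add: order.trans[OF _ le_of_int_ceiling])
  have pos: "exp v > 0" by simp
  show ge: "exp v \<le> real (num_messages v)" unfolding c by simp
  show "1 \<le> num_messages v" using pos ge by (cases "num_messages v = 0") auto
  assume "v \<ge> 0"
  then have "1 \<le> exp v" by simp
  then show "real (num_messages v) \<le> 2 * exp v" unfolding c using of_int_ceiling_le_add_one[of "exp v"] by linarith
qed

text \<open>The quotient is the moment \<open>E exp (t * (X\<^sup>2 - P))\<close> for
  \<open>X\<close> of law \<open>N(0, V)\<close>. It equals 1 at \<open>t = 0\<close> with
  derivative \<open>V - P < 0\<close>, so it drops below 1 for small positive
  \<open>t\<close>.\<close>

lemma chernoff_exponent: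
  fixes P V :: real
  assumes V: "0 < V" "V < P"
  obtains t where "0 < t" "2 * t * V < 1" "exp (- t * P) / sqrt (1 - 2 * t * V) < 1"
proof
  \<comment> \<open>The argument works as soon as \<open>V < P * (1 - 2 * t * V)\<close>; this
    \<open>t\<close> makes the right-hand side the midpoint of \<open>V\<close> and
    \<open>P\<close>.\<close>
  define t where "t = (P - V) / (4 * P * V)"
  have P: "P > 0" using V by simp
  have tV: "2 * t * V = (P - V) / (2 * P)" using V P by (simp add: t_def field_simps)
  show t: "0 < t" unfolding t_def using V P by (intro divide_pos_pos) auto
  show lt: "2 * t * V < 1" unfolding tV using V P by (simp add: field_simps)
  define u where "u = 1 - 2 * t * V"
  have u: "u > 0" using lt by (simp add: u_def)
  have "ln (1 / u) \<le> 1 / u - 1" using u by (intro ln_le_minus_one) simp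
  then have "- ln u \<le> (1 - u) / u" using u by (simp add: ln_div field_simps)
  also have "(1 - u) / u = 2 * t * V / u" by (simp add: u_def)
  also have "\<dots> < 2 * t * P"
  proof -
    have "V < P * u" unfolding u_def tV using V P by (simp add: field_simps)
    then have "2 * t * V < 2 * t * P * u" using t by simp
    then show ?thesis using u by (simp add: divide_less_eq)
  qed
  finally have "- t * P < ln u / 2" by simp
  then have "exp (- t * P) < exp (ln u / 2)" by simp
  also have "exp (ln u / 2) = sqrt u"
  proof -
    have e: "ln u / 2 = ln (sqrt u)" using u ln_sqrt[of u] by simp
    show ?thesis unfolding e using u by simp
  qed
  finally show "exp (- t * P) / sqrt (1 - 2 * t * V) < 1"
    using u by (simp add: u_def[symmetric] divide_less_eq)
qed

lemma eventually_choose_le_exp: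
  fixes k :: "nat \<Rightarrow> nat"
  assumes P: "P > 0" and a: "a > 0" and k: "(\<lambda>n. real (k n)) \<in> O(\<lambda>n. real n)"
  shows "eventually (\<lambda>n. \<forall>d\<in>{1..k n}. real (k n choose d) * 2 ^ d \<le> exp (a * real n * ln (1 + real d * P))) at_top"
proof -
  from k obtain C where C: "C > 0" and kC: "eventually (\<lambda>n. norm (real (k n)) \<le> C * norm (real n)) at_top"
    by (elim landau_o.bigE)
  have "filterlim (\<lambda>d. a * ln (1 + real d * P)) at_top at_top"
    using P a by real_asymp
  then have "eventually (\<lambda>d. a * ln (1 + real d * P) \<ge> C * ln 4) at_top"
    by (auto simp: filterlim_at_top)
  \<comment> \<open>\<open>D\<close> depends on \<open>a\<close>, \<open>C\<close> and
    \<open>P\<close> but not on \<open>n\<close>. From \<open>D\<close> on, the crude bound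
    \<open>4 ^ k n\<close> on \<open>(k n choose d) * 2 ^ d\<close> is good enough; below
    \<open>D\<close> the bound is a polynomial in \<open>n\<close> of bounded degree.\<close>
  then obtain D where D: "\<And>d. d \<ge> D \<Longrightarrow> a * ln (1 + real d * P) \<ge> C * ln 4"
    by (auto simp: eventually_at_top_linorder)
  have lp: "ln (1 + P) > 0" using P by simp
  \<comment> \<open>The \<open>+ 1\<close> keeps the base of the power at least 1, so that the
    exponent may be raised from \<open>d\<close> to \<open>D\<close>.\<close>
  have "eventually (\<lambda>n. real D * ln (2 * C * real n + 1) \<le> a * ln (1 + P) * real n) at_top"
  proof -
    define b where "b = a * ln (1 + P)"
    have b: "b > 0" using a lp by (simp add: b_def)
    have "((\<lambda>n. real D * ln (2 * C * real n + 1) / (b * real n)) \<longlongrightarrow> 0) at_top"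
      using C b by real_asymp
    then have "eventually (\<lambda>n. real D * ln (2 * C * real n + 1) / (b * real n) < 1) at_top"
      by (rule order_tendstoD) simp
    then show ?thesis using eventually_gt_at_top[of 0]
      by eventually_elim (use b in \<open>simp add: b_def[symmetric] divide_less_eq\<close>)
  qed
  with kC show ?thesis
  proof eventually_elim
    case (elim n)
    then have kn: "real (k n) \<le> C * real n" by simp
    show ?case
    proof
      fix d assume d: "d \<in> {1..k n}"
      show "real (k n choose d) * 2 ^ d \<le> exp (a * real n * ln (1 + real d * P))"
      proof (cases "d \<ge> D")
        case True
        have "real (k n choose d) \<le> 2 ^ k n" using binomial_le_pow2[of "k n" d]
          by (metis of_nat_le_iff of_nat_numeral of_nat_power)
        moreover have "(2 :: real) ^ d \<le> 2 ^ k n" using d by (intro power_increasing) auto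
        ultimately have "real (k n choose d) * 2 ^ d \<le> 2 ^ k n * 2 ^ k n" by (intro mult_mono) auto
        also have "\<dots> = (4 :: real) ^ k n" by (simp flip: power_mult_distrib)
        also have "\<dots> = exp (real (k n) * ln 4)" by (simp add: exp_of_nat_mult)
        also have "\<dots> \<le> exp (a * real n * ln (1 + real d * P))"
        proof -
          have "real (k n) * ln 4 \<le> C * real n * ln 4" using kn by (intro mult_right_mono) auto
          also have "\<dots> = C * ln 4 * real n" by simp
          also have "\<dots> \<le> a * ln (1 + real d * P) * real n" by (intro mult_right_mono D True) simp
          finally show ?thesis by (simp add: mult_ac)
        qed
        finally show ?thesis .
      next
        case False
        have "real (k n choose d) \<le> real (k n) ^ d" using binomial_le_pow[of d "k n"] d
          by (metis atLeastAtMost_iff of_nat_le_iff of_nat_power)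
        then have "real (k n choose d) * 2 ^ d \<le> real (k n) ^ d * 2 ^ d" by (intro mult_right_mono) auto
        also have "\<dots> = (2 * real (k n)) ^ d" by (simp add: power_mult_distrib)
        also have "\<dots> \<le> (2 * C * real n + 1) ^ d" using kn by (intro power_mono) auto
        also have "\<dots> \<le> (2 * C * real n + 1) ^ D" using C False by (intro power_increasing) auto
        also have "\<dots> = exp (real D * ln (2 * C * real n + 1))"
          using C by (simp add: exp_of_nat_mult add_nonneg_pos)
        also have "\<dots> \<le> exp (a * real n * ln (1 + real d * P))"
        proof -
          have "real D * ln (2 * C * real n + 1) \<le> a * ln (1 + P) * real n" using elim by simp
          also have "\<dots> \<le> a * ln (1 + real d * P) * real n"
            using ln_one_plus_pos[OF P, of d] d a by (intro mult_right_mono mult_left_mono) auto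
          finally show ?thesis by (simp add: mult_ac)
        qed
        finally show ?thesis .
      qed
    qed
  qed
qed

lemma achievability:
  fixes P \<epsilon> :: real and k :: "nat \<Rightarrow> nat"
  assumes P: "P > 0" and k1: "\<And>n. k n \<ge> 1" and kO: "(\<lambda>n. real (k n)) \<in> O(\<lambda>n. real n)"
    and \<epsilon>: "0 < \<epsilon>" "\<epsilon> < 1"
  shows "asymp_achievable P k (\<lambda>n. (1 - \<epsilon>) * (real n / (2 * real (k n)) * ln (1 + real (k n) * P)))"
proof -
  define v where "v n = (1 - \<epsilon>) * (real n / (2 * real (k n)) * ln (1 + real (k n) * P))" for n
  define M where "M n = num_messages (v n)" for n
  \<comment> \<open>The constants split \<epsilon> in units of \<open>n / 2 * g d\<close>. The
    messages of \<open>d\<close> users take at most \<open>1 - \<epsilon>\<close>, apart from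
    \<open>d * ln 2\<close>; the extra term of \<open>\<gamma>\<close> takes
    \<open>\<epsilon> / 4\<close>; the Chernoff exponent, per unit of \<open>s\<close>, is at least
    \<open>1 - \<epsilon> / 2\<close>, because the reduced variance and the choice of
    \<open>s\<close> each lose a factor \<open>1 - \<epsilon> / 4\<close>. A margin of
    \<open>\<epsilon> / 4\<close> remains, that is \<open>\<epsilon> / 8 * n * g d\<close>, and the
    Chernoff parameter multiplies it by \<open>s\<close>: this gives \<open>c\<close>.\<close>
  define V where "V = (1 - \<epsilon> / 4) * P"
  define s where "s = \<epsilon> / 5"
  define g where "g d = ln (1 + real d * P)" for d
  define \<gamma> where "\<gamma> n d = real d * ln (real (M n)) + \<epsilon> / 8 * real n * g d" for n d
  define c where "c = s * \<epsilon> / 8"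
  have V: "0 < V" "V < P" using P \<epsilon> by (auto simp: V_def)
  obtain t where t: "0 < t" "2 * t * V < 1" "exp (- t * P) / sqrt (1 - 2 * t * V) < 1"
    by (rule chernoff_exponent[OF V])
  define \<rho> where "\<rho> = exp (- t * P) / sqrt (1 - 2 * t * V)"
  have \<rho>: "0 < \<rho>" "\<rho> < 1" using t by (auto simp: \<rho>_def)
  have s: "0 < s" "s < 1" using \<epsilon> by (auto simp: s_def)
  have c: "c > 0" using s \<epsilon> by (simp add: c_def)
  have g: "g d \<ge> ln (1 + P)" "g d > 0" if "d \<ge> 1" for d
    using ln_one_plus_pos[OF P that] by (auto simp: g_def)
  have lp: "ln (1 + P) > 0" using P by simp
  have v0: "v n \<ge> 0" for n
    using \<epsilon> g(2)[OF k1[of n]] by (simp add: v_def g_def)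
  have M1: "M n \<ge> 1" for n unfolding M_def by (rule num_messages_bounds(1))
  have lnM: "ln (real (M n)) \<le> v n + ln 2" for n
  proof -
    have "ln (real (M n)) \<le> ln (2 * exp (v n))"
      using num_messages_bounds(3)[OF v0[of n]] M1[of n] by (simp add: M_def)
    then show ?thesis by (simp add: ln_mult)
  qed
  have dv: "real d * v n \<le> (1 - \<epsilon>) * (real n / 2) * g d" if "d \<in> {1..k n}" for d n
  proof -
    have kp: "real (k n) > 0" using k1[of n] by simp
    have "real d / real (k n) * ln (1 + real (k n) * P) \<le> ln (1 + real d / real (k n) * (real (k n) * P))"
      using that P kp by (intro ln_one_plus_concave) auto
    also have "real d / real (k n) * (real (k n) * P) = real d * P" using kp by simp
    finally have "(1 - \<epsilon>) * (real n / 2) * (real d / real (k n) * ln (1 + real (k n) * P)) \<le> (1 - \<epsilon>) * (real n / 2) * g d"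
      unfolding g_def using \<epsilon> by (intro mult_left_mono) auto
    then show ?thesis by (simp add: v_def field_simps)
  qed
  \<comment> \<open>The 5 in \<open>s = \<epsilon> / 5\<close> is chosen for this bound:
    \<open>1 - s\<^sup>2 \<ge> 4 / 5\<close> makes the quotient at most
    \<open>\<epsilon> / 4\<close>.\<close>
  have s_bound: "s / (1 - s\<^sup>2) \<le> \<epsilon> / 4"
  proof -
    have "s\<^sup>2 \<le> (1/5)\<^sup>2" using \<epsilon> s by (intro power_mono) (auto simp: s_def)
    then have s2: "1 - s\<^sup>2 \<ge> 4/5" by (simp add: power2_eq_square)
    then have "s \<le> \<epsilon> / 4 * (1 - s\<^sup>2)"
      using mult_left_mono[OF s2, of "\<epsilon> / 4"] \<epsilon> by (simp add: s_def)
    then show ?thesis using s2 by (simp add: divide_le_eq)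
  qed
  have gV: "(1 - \<epsilon> / 4) * g d \<le> ln (1 + real d * V)" for d
    using ln_one_plus_concave[of "real d * P" "1 - \<epsilon> / 4"] P \<epsilon> by (simp add: g_def V_def mult_ac)
  define R where "R n = (\<Sum>d=1..k n. real (k n choose d) * (exp (s * \<gamma> n d) *
        exp (- (s / 2) * (1 - s / (1 - s\<^sup>2)) * ln (1 + real d * V)) ^ n + real (M n) ^ d * exp (- \<gamma> n d))) +
      real (k n) * \<rho> ^ n" for n
  have R0: "R n \<ge> 0" for n
    using \<rho> by (auto simp: R_def intro!: add_nonneg_nonneg sum_nonneg)
  have miss: "exp (s * \<gamma> n d) * exp (- (s / 2) * (1 - s / (1 - s\<^sup>2)) * ln (1 + real d * V)) ^ n
      \<le> 2 ^ d * exp (- c * real n * g d)" if d: "d \<in> {1..k n}" for n d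
  proof -
    have gd: "g d > 0" using d by (intro g) simp
    have "(1 - \<epsilon> / 2) * g d \<le> (1 - \<epsilon> / 4) * ((1 - \<epsilon> / 4) * g d)"
    proof -
      have "1 - \<epsilon> / 2 \<le> (1 - \<epsilon> / 4) * (1 - \<epsilon> / 4)" by (simp add: algebra_simps)
      then have "(1 - \<epsilon> / 2) * g d \<le> (1 - \<epsilon> / 4) * (1 - \<epsilon> / 4) * g d"
        using gd by (intro mult_right_mono) auto
      then show ?thesis by (simp add: mult_ac)
    qed
    also have "\<dots> \<le> (1 - s / (1 - s\<^sup>2)) * ln (1 + real d * V)"
    proof (rule mult_mono[OF _ gV])
      show "1 - \<epsilon> / 4 \<le> 1 - s / (1 - s\<^sup>2)" using s_bound by linarith
      then show "0 \<le> 1 - s / (1 - s\<^sup>2)" using \<epsilon> by linarith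
      show "0 \<le> (1 - \<epsilon> / 4) * g d" using \<epsilon> gd by simp
    qed
    finally have low: "(1 - \<epsilon> / 2) * g d \<le> (1 - s / (1 - s\<^sup>2)) * ln (1 + real d * V)" .
    have "s * \<gamma> n d + real n * (- (s / 2) * (1 - s / (1 - s\<^sup>2)) * ln (1 + real d * V))
       = s * (\<gamma> n d - real n / 2 * ((1 - s / (1 - s\<^sup>2)) * ln (1 + real d * V)))"
      by (simp add: algebra_simps)
    also have "\<dots> \<le> s * (real d * ln 2 - \<epsilon> / 8 * real n * g d)"
    proof (intro mult_left_mono)
      have "real d * ln (real (M n)) \<le> real d * (v n + ln 2)" by (intro mult_left_mono lnM) simp
      moreover have "real n / 2 * ((1 - \<epsilon> / 2) * g d) \<le> real n / 2 * ((1 - s / (1 - s\<^sup>2)) * ln (1 + real d * V))"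
        by (intro mult_left_mono low) simp
      moreover note dv[OF d]
      ultimately show "\<gamma> n d - real n / 2 * ((1 - s / (1 - s\<^sup>2)) * ln (1 + real d * V)) \<le> real d * ln 2 - \<epsilon> / 8 * real n * g d"
        unfolding \<gamma>_def by (simp add: algebra_simps)
    qed (use s in simp)
    also have "\<dots> \<le> real d * ln 2 - c * real n * g d"
    proof -
      have "s * (real d * ln 2) \<le> 1 * (real d * ln 2)" using s by (intro mult_right_mono) auto
      then show ?thesis by (simp add: c_def algebra_simps)
    qed
    finally have "exp (s * \<gamma> n d + real n * (- (s / 2) * (1 - s / (1 - s\<^sup>2)) * ln (1 + real d * V)))
      \<le> exp (real d * ln 2 + - c * real n * g d)" by simp
    moreover have "exp (ln 2) = (2 :: real)" by simp
    ultimately show ?thesis by (simp only: exp_add exp_of_nat_mult)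
  qed
  have false: "real (M n) ^ d * exp (- \<gamma> n d) \<le> 2 ^ d * exp (- c * real n * g d)" if d: "d \<in> {1..k n}" for n d
  proof -
    have gd: "g d > 0" using d by (intro g) simp
    have "real (M n) ^ d = exp (real d * ln (real (M n)))" using M1[of n] by (simp add: exp_of_nat_mult)
    then have "real (M n) ^ d * exp (- \<gamma> n d) = 1 * exp (- (\<epsilon> / 8 * real n * g d))"
      by (simp add: \<gamma>_def flip: exp_add)
    also have "\<dots> \<le> 2 ^ d * exp (- c * real n * g d)"
    proof (intro mult_mono)
      have "s * (\<epsilon> / 8 * real n * g d) \<le> 1 * (\<epsilon> / 8 * real n * g d)"
        using s \<epsilon> gd by (intro mult_right_mono) auto
      then show "exp (- (\<epsilon> / 8 * real n * g d)) \<le> exp (- c * real n * g d)"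
        by (simp add: c_def)
    qed auto
    finally show ?thesis .
  qed
  obtain C where C: "C > 0" and kC: "eventually (\<lambda>n. norm (real (k n)) \<le> C * norm (real n)) at_top"
    using kO by (elim landau_o.bigE)
  \<comment> \<open>Half of the exponent \<open>c\<close> pays for the number of sets and for
    \<open>2 ^ d\<close>; the other half, bounded below by its value at \<open>d = 1\<close>, gives
    the decay rate \<open>b\<close>.\<close>
  have c2: "c / 2 > 0" using c by simp
  define b where "b = c / 2 * ln (1 + P)"
  have b: "b > 0" using c lp by (simp add: b_def)
  have upper: "eventually (\<lambda>n. R n \<le> 2 * (C * real n) * exp (- (b * real n)) + C * real n * \<rho> ^ n) at_top"
    using eventually_choose_le_exp[OF P c2 kO] kC
  proof eventually_elim
    case (elim n)
    have kn: "real (k n) \<le> C * real n" using elim(2) by simp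
    have "(\<Sum>d=1..k n. real (k n choose d) * (exp (s * \<gamma> n d) *
        exp (- (s / 2) * (1 - s / (1 - s\<^sup>2)) * ln (1 + real d * V)) ^ n + real (M n) ^ d * exp (- \<gamma> n d)))
      \<le> (\<Sum>d=1..k n. 2 * exp (- (b * real n)))"
    proof (rule sum_mono)
      fix d assume d: "d \<in> {1..k n}"
      have "real (k n choose d) * (exp (s * \<gamma> n d) *
          exp (- (s / 2) * (1 - s / (1 - s\<^sup>2)) * ln (1 + real d * V)) ^ n + real (M n) ^ d * exp (- \<gamma> n d))
        \<le> real (k n choose d) * (2 ^ d * exp (- c * real n * g d) + 2 ^ d * exp (- c * real n * g d))"
        by (intro mult_left_mono add_mono miss false d) simp
      also have "\<dots> = 2 * (real (k n choose d) * 2 ^ d) * exp (- c * real n * g d)" by simp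
      also have "\<dots> \<le> 2 * exp (c / 2 * real n * g d) * exp (- c * real n * g d)"
        using elim(1) d by (intro mult_right_mono mult_left_mono) (auto simp: g_def)
      also have "\<dots> = 2 * exp (- (c / 2 * real n * g d))"
        by (simp add: mult.assoc flip: exp_add)
      also have "\<dots> \<le> 2 * exp (- (b * real n))"
      proof -
        have "c / 2 * real n * ln (1 + P) \<le> c / 2 * real n * g d"
          using c d by (intro mult_left_mono g) auto
        then show ?thesis by (simp add: b_def mult_ac)
      qed
      finally show "real (k n choose d) * (exp (s * \<gamma> n d) *
          exp (- (s / 2) * (1 - s / (1 - s\<^sup>2)) * ln (1 + real d * V)) ^ n + real (M n) ^ d * exp (- \<gamma> n d))
        \<le> 2 * exp (- (b * real n))" .
    qed
    also have "\<dots> = 2 * real (k n) * exp (- (b * real n))" by simp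
    also have "\<dots> \<le> 2 * (C * real n) * exp (- (b * real n))"
      using kn by (intro mult_right_mono mult_left_mono) auto
    finally have "R n \<le> 2 * (C * real n) * exp (- (b * real n)) + real (k n) * \<rho> ^ n"
      unfolding R_def by simp
    also have "real (k n) * \<rho> ^ n \<le> C * real n * \<rho> ^ n"
      using kn \<rho> by (intro mult_right_mono) auto
    finally show ?case by simp
  qed
  have "(\<lambda>n. 2 * (C * real n) * exp (- (b * real n)) + C * real n * \<rho> ^ n) \<longlonglongrightarrow> 0"
  proof -
    define r where "r = - ln \<rho>"
    have r: "r > 0" using \<rho> by (simp add: r_def)
    have "\<rho> ^ n = exp (- (r * real n))" for n
      using \<rho> exp_of_nat_mult[of n "ln \<rho>"] by (simp add: r_def mult.commute)
    moreover have "(\<lambda>n. 2 * (C * real n) * exp (- (b * real n))) \<longlonglongrightarrow> 0"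
      using b C by real_asymp
    moreover have "(\<lambda>n. C * real n * exp (- (r * real n))) \<longlonglongrightarrow> 0"
      using r C by real_asymp
    ultimately show ?thesis by (simp only:) (rule tendsto_add_zero)
  qed
  from tendsto_sandwich[OF always_eventually[OF allI[OF R0]] upper tendsto_const this]
  have Rlim: "R \<longlonglongrightarrow> 0" .
  \<comment> \<open>The vanishing term \<open>1 / (n + 1)\<close> provides the strict inequality
    that the random coding bound asks for.\<close>
  have "\<exists>cw D. valid_code P n (k n) (M n) cw D \<and> avg_error n (k n) (M n) cw D \<le> R n + 1 / (real n + 1)" for n
  proof (rule random_coding_bound[OF V(1) s t(1,2) _ M1])
    show "(\<Sum>d=1..k n. real (k n choose d) * (exp (s * \<gamma> n d) *
        exp (- (s / 2) * (1 - s / (1 - s\<^sup>2)) * ln (1 + real d * V)) ^ n + real (M n) ^ d * exp (- \<gamma> n d))) +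
      real (k n) * (exp (- t * P) / sqrt (1 - 2 * t * V)) ^ n < R n + 1 / (real n + 1)"
      unfolding R_def \<rho>_def by simp
  qed (use P in simp)
  then obtain cw D where code: "\<And>n. valid_code P n (k n) (M n) (cw n) (D n)"
      "\<And>n. avg_error n (k n) (M n) (cw n) (D n) \<le> R n + 1 / (real n + 1)"
    by metis
  have "(\<lambda>n. 1 / (real n + 1)) \<longlonglongrightarrow> 0" by real_asymp
  with Rlim have "(\<lambda>n. R n + 1 / (real n + 1)) \<longlonglongrightarrow> 0" by (rule tendsto_add_zero)
  moreover have "0 \<le> avg_error n (k n) (M n) (cw n) (D n)" for n
    unfolding avg_error_def by (intro mult_nonneg_nonneg sum_nonneg measure_nonneg) simp
  ultimately have "(\<lambda>n. avg_error n (k n) (M n) (cw n) (D n)) \<longlonglongrightarrow> 0"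
    by (intro tendsto_sandwich[OF always_eventually[OF allI] always_eventually[OF allI[OF code(2)]] tendsto_const])
  with code(1) show ?thesis
    unfolding asymp_achievable_def v_def[symmetric] M_def[symmetric] by blast
qed

section \<open>Converse\<close>

lemma sum_PiE_insert:
  fixes F :: "('a \<Rightarrow> 'b) \<Rightarrow> 'c :: comm_monoid_add"
  assumes "i \<notin> I"
  shows "(\<Sum>w\<in>PiE (insert i I) X. F w) = (\<Sum>x\<in>X i. \<Sum>w\<in>PiE I X. F (w(i := x)))"
proof -
  have inj: "inj_on (\<lambda>(x, w). w(i := x)) (X i \<times> PiE I X)"
    by (rule inj_combinator[OF assms])
  show ?thesis
    unfolding PiE_insert_eq sum.reindex[OF inj] sum.cartesian_product
    by (simp add: case_prod_unfold)
qed

text \<open>Counting form of the additivity of variance for independent centred variables. The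
  vanishing mean is carried along in the induction because it kills the cross term
  \<open>2 * b i x * S w\<close>; the factor \<open>card X\<close> on the left avoids the exponent
  \<open>card I - 1\<close> on the right.\<close>

lemma sum_PiE_centered_squares:
  fixes b :: "'a \<Rightarrow> 'b \<Rightarrow> real"
  assumes "finite I" and X: "finite X" and b: "\<And>i. i \<in> I \<Longrightarrow> (\<Sum>x\<in>X. b i x) = 0"
  shows "(\<Sum>w\<in>PiE I (\<lambda>_. X). \<Sum>i\<in>I. b i (w i)) = 0 \<and>
    real (card X) * (\<Sum>w\<in>PiE I (\<lambda>_. X). (\<Sum>i\<in>I. b i (w i))\<^sup>2) =
      real (card X) ^ card I * (\<Sum>i\<in>I. \<Sum>x\<in>X. (b i x)\<^sup>2)"
  using assms(1) b
proof (induction I)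
  case (insert i I)
  define S where "S w = (\<Sum>j\<in>I. b j (w j))" for w
  have S: "(\<Sum>j\<in>insert i I. b j ((w(i := x)) j)) = b i x + S w" for w x
  proof -
    have "(\<Sum>j\<in>I. b j ((w(i := x)) j)) = S w"
      unfolding S_def using insert.hyps by (intro sum.cong) auto
    then show ?thesis using insert.hyps by simp
  qed
  have bi: "(\<Sum>x\<in>X. b i x) = 0" using insert.prems by simp
  have IH: "(\<Sum>w\<in>PiE I (\<lambda>_. X). S w) = 0"
    "real (card X) * (\<Sum>w\<in>PiE I (\<lambda>_. X). (S w)\<^sup>2) = real (card X) ^ card I * (\<Sum>i\<in>I. \<Sum>x\<in>X. (b i x)\<^sup>2)"
    using insert.IH insert.prems by (auto simp: S_def)
  have cardP: "card (PiE I (\<lambda>_. X)) = card X ^ card I"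
    using insert.hyps by (simp add: card_PiE)
  have 1: "(\<Sum>w\<in>PiE (insert i I) (\<lambda>_. X). \<Sum>j\<in>insert i I. b j (w j)) = 0"
    unfolding sum_PiE_insert[OF insert.hyps(2)] S
    by (simp add: sum.distrib IH(1) bi flip: sum_distrib_left)
  have "(\<Sum>w\<in>PiE (insert i I) (\<lambda>_. X). (\<Sum>j\<in>insert i I. b j (w j))\<^sup>2) =
      (\<Sum>x\<in>X. \<Sum>w\<in>PiE I (\<lambda>_. X). (b i x)\<^sup>2 + 2 * b i x * S w + (S w)\<^sup>2)"
    unfolding sum_PiE_insert[OF insert.hyps(2)] S by (simp add: power2_sum algebra_simps)
  also have "\<dots> = (\<Sum>x\<in>X. real (card X) ^ card I * (b i x)\<^sup>2) + real (card X) * (\<Sum>w\<in>PiE I (\<lambda>_. X). (S w)\<^sup>2)"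
    by (simp add: sum.distrib cardP IH(1) flip: sum_distrib_left)
  also have "\<dots> = real (card X) ^ card I * (\<Sum>i\<in>insert i I. \<Sum>x\<in>X. (b i x)\<^sup>2)"
    unfolding IH(2) using insert.hyps by (simp add: sum_distrib_left algebra_simps)
  finally show ?case using 1 insert.hyps by simp
qed simp

section \<open>Change of measure to a Gaussian reference output\<close>

lemma normal_density_tilt:
  assumes Q: "Q \<ge> 0"
  shows "normal_density 0 1 z * exp (- info Q x (x + z)) = normal_density 0 (sqrt (1 + Q)) (x + z)"
proof -
  have e: "exp (ln (1 + Q) / 2) = sqrt (1 + Q)"
  proof -
    have e: "ln (1 + Q) / 2 = ln (sqrt (1 + Q))" using Q ln_sqrt[of "1 + Q"] by simp
    show ?thesis unfolding e using Q by simp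
  qed
  have "normal_density 0 1 z * exp (- info Q x (x + z)) =
      1 / sqrt (2 * pi) * exp (- (z\<^sup>2) / 2 + (- (ln (1 + Q) / 2) + (- ((x + z)\<^sup>2 / (2 * (1 + Q))) + z\<^sup>2 / 2)))"
    by (simp add: normal_density_def info_def flip: exp_add)
  also have "\<dots> = 1 / sqrt (2 * pi) * exp (- (ln (1 + Q) / 2) + - ((x + z)\<^sup>2 / (2 * (1 + Q))))"
    by simp
  also have "\<dots> = 1 / sqrt (2 * pi) * (inverse (sqrt (1 + Q)) * exp (- ((x + z)\<^sup>2 / (2 * (1 + Q)))))"
    unfolding exp_add exp_minus[of "ln (1 + Q) / 2"] e ..
  also have "\<dots> = normal_density 0 (sqrt (1 + Q)) (x + z)"
  proof -
    have "sqrt (2 * pi * (1 + Q)) = sqrt (2 * pi) * sqrt (1 + Q)" by (rule real_sqrt_mult)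
    then show ?thesis using Q by (simp add: normal_density_def divide_inverse)
  qed
  finally show ?thesis .
qed

lemma nn_integral_gauss_tilt:
  assumes Q: "Q \<ge> 0" and A: "A \<in> sets borel"
  shows "(\<integral>\<^sup>+z. ennreal (exp (- info Q x (x + z))) * indicator A (x + z) \<partial>gauss 1) = emeasure (gauss (1 + Q)) A"
proof -
  have "(\<integral>\<^sup>+z. ennreal (exp (- info Q x (x + z))) * indicator A (x + z) \<partial>gauss 1) =
      (\<integral>\<^sup>+z. ennreal (normal_density 0 1 z) * (ennreal (exp (- info Q x (x + z))) * indicator A (x + z)) \<partial>lborel)"
    unfolding gauss_def using A by (subst nn_integral_density) (auto simp: real_sqrt_one)
  also have "\<dots> = (\<integral>\<^sup>+z. ennreal (normal_density 0 (sqrt (1 + Q)) (x + 1 * z)) * indicator A (x + 1 * z) \<partial>lborel)"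
    by (intro nn_integral_cong)
       (simp add: mult.assoc[symmetric] normal_density_tilt[OF Q, symmetric] ennreal_mult)
  also have "\<dots> = (\<integral>\<^sup>+y. ennreal (normal_density 0 (sqrt (1 + Q)) y) * indicator A y \<partial>lborel)"
    using A by (subst (2) nn_integral_real_affine[where c = 1 and t = x]) auto
  also have "\<dots> = emeasure (gauss (1 + Q)) A"
    unfolding gauss_def using A by (subst emeasure_density) auto
  finally show ?thesis .
qed

text \<open>Weighting by the inverse likelihood ratio and shifting the noise by \<open>x\<close>
  gives the reference law whatever \<open>x\<close> is, so all message tuples can be compared with
  one and the same law. It is enough to check boxes, on which everything factorises over
  time.\<close>

lemma distr_noise_tilt:
  assumes Q: "Q \<ge> 0"
  shows "distr (density (noise n) (\<lambda>z. \<Prod>i<n. ennreal (exp (- info Q (x i) (x i + z i)))))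
      (PiM {..<n} (\<lambda>_. gauss (1 + Q))) (\<lambda>z. \<lambda>i\<in>{..<n}. x i + z i) = PiM {..<n} (\<lambda>_. gauss (1 + Q))"
    (is "distr ?D ?P ?f = ?P")
proof -
  interpret P: product_prob_space "\<lambda>_. gauss (1 + Q)" "{..<n}"
    using Q by (intro product_prob_space_gauss) simp
  interpret G: product_prob_space "\<lambda>_. gauss 1" "{..<n}"
    by (intro product_prob_space_gauss) simp
  note comp = measurable_noise_component[of _ n]
  have m: "(\<lambda>z. \<Prod>i<n. ennreal (exp (- info Q (x i) (x i + z i)))) \<in> borel_measurable (noise n)"
    by (intro borel_measurable_prod_ennreal measurable_compose[OF _ measurable_ennreal]
        measurable_compose[OF _ borel_measurable_exp] borel_measurable_uminus borel_measurable_info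
        borel_measurable_add borel_measurable_const comp) auto
  have f: "?f \<in> noise n \<rightarrow>\<^sub>M ?P"
    using comp by (intro measurable_restrict) (simp add: measurable_cong_sets[OF refl sets_gauss])
  show ?thesis
  proof (rule P.PiM_eqI)
    fix A :: "nat \<Rightarrow> real set" assume A: "\<And>i. i \<in> {..<n} \<Longrightarrow> A i \<in> sets (gauss (1 + Q))"
    have PA: "PiE {..<n} A \<in> sets ?P" using A by (intro sets_PiM_I_finite) auto
    have "emeasure (distr ?D ?P ?f) (PiE {..<n} A) = emeasure ?D (?f -` PiE {..<n} A \<inter> space ?D)"
      using f PA by (intro emeasure_distr) simp_all
    also have "\<dots> = (\<integral>\<^sup>+z. (\<Prod>i<n. ennreal (exp (- info Q (x i) (x i + z i)))) *
        indicator (?f -` PiE {..<n} A \<inter> space ?D) z \<partial>noise n)"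
      using m f PA by (intro emeasure_density) (auto intro: measurable_sets)
    also have "\<dots> = (\<integral>\<^sup>+z. (\<Prod>i<n. ennreal (exp (- info Q (x i) (x i + z i))) * indicator (A i) (x i + z i)) \<partial>noise n)"
    proof (intro nn_integral_cong)
      fix z assume z: "z \<in> space (noise n)"
      have "indicator (?f -` PiE {..<n} A \<inter> space ?D) z = (\<Prod>i<n. indicator (A i) (x i + z i) :: ennreal)"
      proof (cases "\<forall>i<n. x i + z i \<in> A i")
        case True
        then have "?f z \<in> PiE {..<n} A" by auto
        with z True show ?thesis by simp
      next
        case False
        then obtain i where i: "i < n" "x i + z i \<notin> A i" by auto
        then have "?f z \<notin> PiE {..<n} A" by (auto simp: PiE_iff)
        moreover have "(\<Prod>i<n. indicator (A i) (x i + z i) :: ennreal) = 0"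
          using i by (intro prod_zero bexI[of _ i]) auto
        ultimately show ?thesis by simp
      qed
      then show "(\<Prod>i<n. ennreal (exp (- info Q (x i) (x i + z i)))) * indicator (?f -` PiE {..<n} A \<inter> space ?D) z =
        (\<Prod>i<n. ennreal (exp (- info Q (x i) (x i + z i))) * indicator (A i) (x i + z i))"
        by (simp add: prod.distrib)
    qed
    also have "\<dots> = (\<Prod>i<n. \<integral>\<^sup>+v. ennreal (exp (- info Q (x i) (x i + v))) * indicator (A i) (x i + v) \<partial>gauss 1)"
      unfolding noise_eq using A by (intro G.product_nn_integral_prod) auto
    also have "\<dots> = (\<Prod>i<n. emeasure (gauss (1 + Q)) (A i))"
      using A Q by (intro prod.cong nn_integral_gauss_tilt) auto
    finally show "emeasure (distr ?D ?P ?f) (PiE {..<n} A) = (\<Prod>i<n. emeasure (gauss (1 + Q)) (A i))" .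
  qed auto
qed

lemma nn_integral_noise_tilt:
  assumes Q: "Q \<ge> 0" and f: "f \<in> borel_measurable (PiM {..<n} (\<lambda>_. gauss (1 + Q)))"
  shows "(\<integral>\<^sup>+z. (\<Prod>i<n. ennreal (exp (- info Q (x i) (x i + z i)))) * f (\<lambda>i\<in>{..<n}. x i + z i) \<partial>noise n) =
    (\<integral>\<^sup>+y. f y \<partial>PiM {..<n} (\<lambda>_. gauss (1 + Q)))"
proof -
  let ?P = "PiM {..<n} (\<lambda>_. gauss (1 + Q))" and ?f = "\<lambda>z. \<lambda>i\<in>{..<n}. x i + z i"
  note comp = measurable_noise_component[of _ n]
  have m: "(\<lambda>z. \<Prod>i<n. ennreal (exp (- info Q (x i) (x i + z i)))) \<in> borel_measurable (noise n)"
    by (intro borel_measurable_prod_ennreal measurable_compose[OF _ measurable_ennreal]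
        measurable_compose[OF _ borel_measurable_exp] borel_measurable_uminus borel_measurable_info
        borel_measurable_add borel_measurable_const comp) auto
  have g: "?f \<in> noise n \<rightarrow>\<^sub>M ?P"
    using comp by (intro measurable_restrict) (simp add: measurable_cong_sets[OF refl sets_gauss])
  have "(\<integral>\<^sup>+y. f y \<partial>?P) =
      integral\<^sup>N (distr (density (noise n) (\<lambda>z. \<Prod>i<n. ennreal (exp (- info Q (x i) (x i + z i))))) ?P ?f) f"
    by (rule arg_cong[OF distr_noise_tilt[OF Q, symmetric]])
  also have "\<dots> = (\<integral>\<^sup>+z. f (?f z) \<partial>density (noise n) (\<lambda>z. \<Prod>i<n. ennreal (exp (- info Q (x i) (x i + z i)))))"
    using g f by (intro nn_integral_distr) simp_all
  also have "\<dots> = (\<integral>\<^sup>+z. (\<Prod>i<n. ennreal (exp (- info Q (x i) (x i + z i)))) * f (?f z) \<partial>noise n)"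
    using m measurable_compose[OF g f] by (intro nn_integral_density)
  finally show ?thesis ..
qed

text \<open>The mean is the relative entropy of \<open>N(x, 1)\<close> with respect to
  \<open>N(0, 1 + Q)\<close>. The integrand is a quadratic polynomial in \<open>v\<close>, so the
  moments of the standard normal up to order 2 determine it.\<close>

lemma gauss_info_moment:
  assumes Q: "Q \<ge> 0"
  shows "integrable (gauss 1) (\<lambda>v. info Q x (x + v))"
    and "(\<integral>v. info Q x (x + v) \<partial>gauss 1) = ln (1 + Q) / 2 + (x\<^sup>2 + 1) / (2 * (1 + Q)) - 1 / 2"
proof -
  define a where "a = 1 / (2 * (1 + Q)) - 1 / 2"
  define b where "b = x / (1 + Q)"
  define c where "c = ln (1 + Q) / 2 + x\<^sup>2 / (2 * (1 + Q))"
  have e: "info Q x (x + v) = a * v\<^sup>2 + b * v + c" for v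
  proof -
    have "ln R / 2 + (x + v)\<^sup>2 / (2 * R) - (x + v - x)\<^sup>2 / 2 =
        (1 / (2 * R) - 1 / 2) * v\<^sup>2 + x / R * v + (ln R / 2 + x\<^sup>2 / (2 * R))" for R
      by (simp add: power2_sum add_divide_distrib left_diff_distrib)
    from this[of "1 + Q"] show ?thesis unfolding info_def a_def b_def c_def .
  qed
  have 0: "has_bochner_integral lborel (\<lambda>v. std_normal_density v) 1"
    using std_normal_moment_even[of 0] by simp
  have 1: "has_bochner_integral lborel (\<lambda>v. std_normal_density v * v) 0"
    using std_normal_moment_odd[of 0] by simp
  have 2: "has_bochner_integral lborel (\<lambda>v. std_normal_density v * v\<^sup>2) 1"
    using std_normal_moment_even[of 1] by simp
  have "has_bochner_integral lborel
      (\<lambda>v. a * (std_normal_density v * v\<^sup>2) + b * (std_normal_density v * v) + c * std_normal_density v) (a * 1 + b * 0 + c * 1)"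
    by (intro has_bochner_integral_add has_bochner_integral_mult_right 0 1 2)
  also have "(\<lambda>v. a * (std_normal_density v * v\<^sup>2) + b * (std_normal_density v * v) + c * std_normal_density v) =
      (\<lambda>v. std_normal_density v *\<^sub>R info Q x (x + v))"
    unfolding e by (simp add: algebra_simps)
  finally have h: "has_bochner_integral (gauss 1) (\<lambda>v. info Q x (x + v)) (a + c)"
    unfolding gauss_def by (intro has_bochner_integral_density) (auto simp: has_bochner_integral_density)
  then show "integrable (gauss 1) (\<lambda>v. info Q x (x + v))" by (rule integrable.intros)
  have "(\<integral>v. info Q x (x + v) \<partial>gauss 1) = a + c" using h by (rule has_bochner_integral_integral_eq)
  then show "(\<integral>v. info Q x (x + v) \<partial>gauss 1) = ln (1 + Q) / 2 + (x\<^sup>2 + 1) / (2 * (1 + Q)) - 1 / 2"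
    by (simp add: a_def c_def add_divide_distrib)
qed

lemma distr_noise_component:
  assumes "i < n"
  shows "distr (noise n) (gauss 1) (\<lambda>z. z i) = gauss 1"
  unfolding noise_eq using assms by (intro distr_PiM_component prob_space_gauss) auto

lemma noise_info_moment:
  fixes x :: "nat \<Rightarrow> real"
  assumes Q: "Q \<ge> 0"
  shows "integrable (noise n) (\<lambda>z. \<Sum>i<n. info Q (x i) (x i + z i))"
    and "(\<integral>z. (\<Sum>i<n. info Q (x i) (x i + z i)) \<partial>noise n) =
      (\<Sum>i<n. ln (1 + Q) / 2 + ((x i)\<^sup>2 + 1) / (2 * (1 + Q)) - 1 / 2)"
proof -
  have c: "(\<lambda>z. z i) \<in> noise n \<rightarrow>\<^sub>M gauss 1" if "i < n" for i
    using measurable_noise_component[OF that] by (simp add: measurable_cong_sets[OF refl sets_gauss])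
  have m: "(\<lambda>v. info Q (x i) (x i + v)) \<in> borel_measurable (gauss 1)" for i
    by measurable
  have int: "integrable (noise n) (\<lambda>z. info Q (x i) (x i + z i))" if "i \<in> {..<n}" for i
    using integrable_distr_eq[OF c m, of i] distr_noise_component[of i n] that gauss_info_moment(1)[OF Q] by simp
  show "integrable (noise n) (\<lambda>z. \<Sum>i<n. info Q (x i) (x i + z i))"
    by (rule Bochner_Integration.integrable_sum[OF int])
  have "(\<integral>z. (\<Sum>i<n. info Q (x i) (x i + z i)) \<partial>noise n) = (\<Sum>i<n. \<integral>z. info Q (x i) (x i + z i) \<partial>noise n)"
    by (rule Bochner_Integration.integral_sum[OF int])
  also have "\<dots> = (\<Sum>i<n. ln (1 + Q) / 2 + ((x i)\<^sup>2 + 1) / (2 * (1 + Q)) - 1 / 2)"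
  proof (intro sum.cong refl)
    fix i assume "i \<in> {..<n}"
    then show "(\<integral>z. info Q (x i) (x i + z i) \<partial>noise n) = ln (1 + Q) / 2 + ((x i)\<^sup>2 + 1) / (2 * (1 + Q)) - 1 / 2"
      using integral_distr[OF c m, of i] distr_noise_component[of i n] gauss_info_moment(2)[OF Q] by simp
  qed
  finally show "(\<integral>z. (\<Sum>i<n. info Q (x i) (x i + z i)) \<partial>noise n) =
      (\<Sum>i<n. ln (1 + Q) / 2 + ((x i)\<^sup>2 + 1) / (2 * (1 + Q)) - 1 / 2)" .
qed

text \<open>This is Young's inequality \<open>p f \<le> p ln (p / q) + q exp f - p\<close>, integrated for \<open>f = t\<close> on \<open>B\<close> and \<open>0\<close> elsewhere.\<close>

lemma change_of_measure_bound:
  fixes x :: "nat \<Rightarrow> real"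
  assumes Q: "Q \<ge> 0" and t: "t \<ge> 0" and B: "B \<in> sets (PiM {..<n} (\<lambda>_. gauss (1 + Q)))"
  shows "t * measure (noise n) {z \<in> space (noise n). (\<lambda>i\<in>{..<n}. x i + z i) \<in> B} \<le>
    (\<Sum>i<n. ln (1 + Q) / 2 + ((x i)\<^sup>2 + 1) / (2 * (1 + Q)) - 1 / 2) +
    (exp t - 1) * measure (PiM {..<n} (\<lambda>_. gauss (1 + Q))) B"
proof -
  let ?P = "PiM {..<n} (\<lambda>_. gauss (1 + Q))" and ?f = "\<lambda>z. \<lambda>i\<in>{..<n}. x i + z i"
  interpret P: prob_space ?P using Q by (intro prob_space_PiM prob_space_gauss) simp
  interpret Z: prob_space "noise n" by (rule prob_space_noise)
  define L where "L z = (\<Sum>i<n. info Q (x i) (x i + z i))" for z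
  define A where "A = {z \<in> space (noise n). ?f z \<in> B}"
  note comp = measurable_noise_component[of _ n]
  have f: "?f \<in> noise n \<rightarrow>\<^sub>M ?P"
    using comp by (intro measurable_restrict) (simp add: measurable_cong_sets[OF refl sets_gauss])
  have A: "A \<in> sets (noise n)"
    using measurable_sets[OF f B] by (simp add: A_def vimage_def Int_def conj_commute)
  have L: "integrable (noise n) L" "(\<integral>z. L z \<partial>noise n) = (\<Sum>i<n. ln (1 + Q) / 2 + ((x i)\<^sup>2 + 1) / (2 * (1 + Q)) - 1 / 2)"
    unfolding L_def by (rule noise_info_moment[OF Q])+
  \<comment> \<open>\<open>h\<close> is \<open>exp f\<close> as a function of the output:
    \<open>exp t\<close> on \<open>B\<close> and 1 elsewhere, so its integral under the reference
    law is affine in the mass of \<open>B\<close>. \<open>G\<close> multiplies it by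
    \<open>exp (- L z)\<close>, the ratio \<open>q / p\<close>.\<close>
  define h where "h y = 1 + (exp t - 1) * indicator B y" for y :: "nat \<Rightarrow> real"
  have h0: "h y \<ge> 0" for y using t by (simp add: h_def)
  define G where "G z = exp (- L z) * h (?f z)" for z
  have "(\<integral>\<^sup>+z. ennreal (G z) \<partial>noise n) = (\<integral>\<^sup>+z. (\<Prod>i<n. ennreal (exp (- info Q (x i) (x i + z i)))) * ennreal (h (?f z)) \<partial>noise n)"
    by (intro nn_integral_cong)
       (simp add: G_def L_def h0 prod_ennreal ennreal_mult exp_sum sum_negf[symmetric] prod_nonneg)
  also have "\<dots> = (\<integral>\<^sup>+y. ennreal (h y) \<partial>?P)"
    using B by (intro nn_integral_noise_tilt[OF Q]) (simp add: h_def)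
  also have "\<dots> = (\<integral>\<^sup>+y. 1 + ennreal (exp t - 1) * indicator B y \<partial>?P)"
  proof (intro nn_integral_cong)
    fix y
    have "ennreal (1 + (exp t - 1)) = 1 + ennreal (exp t - 1)" using t by (subst ennreal_plus) auto
    then show "ennreal (h y) = 1 + ennreal (exp t - 1) * indicator B y"
      by (simp add: h_def split: split_indicator)
  qed
  also have "\<dots> = 1 + ennreal (exp t - 1) * emeasure ?P B"
    using B by (simp add: nn_integral_add nn_integral_cmult_indicator P.emeasure_space_1)
  also have "\<dots> = ennreal (1 + (exp t - 1) * measure ?P B)"
    using t by (simp add: P.emeasure_eq_measure ennreal_mult ennreal_plus)
  finally have nn: "(\<integral>\<^sup>+z. ennreal (G z) \<partial>noise n) = ennreal (1 + (exp t - 1) * measure ?P B)" .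
  have Gm: "G \<in> borel_measurable (noise n)"
  proof -
    have "(\<lambda>y. h y) \<in> borel_measurable ?P" using B unfolding h_def by measurable
    from measurable_compose[OF f this] borel_measurable_integrable[OF L(1)]
    show ?thesis unfolding G_def by measurable
  qed
  have hb: "has_bochner_integral (noise n) G (1 + (exp t - 1) * measure ?P B)"
    using Gm nn h0 t by (intro has_bochner_integral_nn_integral) (auto simp: G_def)
  have young: "t * indicator A z \<le> L z + (G z - 1)" if "z \<in> space (noise n)" for z
  proof -
    have "ln (h (?f z)) = t * indicator A z"
      using that by (simp add: h_def A_def split: split_indicator)
    moreover have "h (?f z) > 0" using t by (simp add: h_def split: split_indicator)
    ultimately have "G z = exp (t * indicator A z - L z)"
      by (simp add: G_def exp_diff exp_minus divide_inverse) (metis exp_ln)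
    moreover have "1 + (t * indicator A z - L z) \<le> exp (t * indicator A z - L z)" by (rule exp_ge_add_one_self)
    ultimately show ?thesis by linarith
  qed
  have "t * measure (noise n) A = (\<integral>z. t * indicator A z \<partial>noise n)" using A by simp
  also have "\<dots> \<le> (\<integral>z. L z + (G z - 1) \<partial>noise n)"
    using A L(1) hb young by (intro integral_mono) (auto simp: has_bochner_integral_iff Z.emeasure_eq_measure)
  also have "\<dots> = (\<integral>z. L z \<partial>noise n) + (exp t - 1) * measure ?P B"
    using L(1) hb by (simp add: has_bochner_integral_iff Z.prob_space)
  finally show ?thesis unfolding L(2) A_def .
qed

section \<open>From disjoint decoding regions to the rate bound\<close>

lemma codeword_power:
  assumes "valid_code P n k M s D" "j < k" "x \<in> {1..M}"
  shows "(\<Sum>i<n. (s j x i)\<^sup>2) \<le> real n * P"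
proof (cases "n = 0")
  case False
  then show ?thesis using assms unfolding valid_code_def by (simp add: field_simps)
qed simp

lemma sum_centered_squares_le:
  fixes f :: "'a \<Rightarrow> real"
  assumes "finite X" "X \<noteq> {}"
  shows "(\<Sum>x\<in>X. (f x - (\<Sum>x'\<in>X. f x') / real (card X))\<^sup>2) \<le> (\<Sum>x\<in>X. (f x)\<^sup>2)"
proof -
  define m where "m = (\<Sum>x'\<in>X. f x') / real (card X)"
  have c: "real (card X) > 0" using assms by (simp add: card_gt_0_iff)
  have m: "(\<Sum>x\<in>X. f x) = real (card X) * m" using c by (simp add: m_def)
  have "(\<Sum>x\<in>X. (f x - m)\<^sup>2) = (\<Sum>x\<in>X. (f x)\<^sup>2 - 2 * m * f x + m\<^sup>2)"
    by (intro sum.cong) (auto simp: power2_diff mult_ac)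
  also have "\<dots> = (\<Sum>x\<in>X. (f x)\<^sup>2) - 2 * m * (\<Sum>x\<in>X. f x) + real (card X) * m\<^sup>2"
    by (simp add: sum.distrib sum_subtractf sum_distrib_left)
  also have "\<dots> = (\<Sum>x\<in>X. (f x)\<^sup>2) - real (card X) * m\<^sup>2"
    unfolding m by (simp add: power2_eq_square)
  also have "\<dots> \<le> (\<Sum>x\<in>X. (f x)\<^sup>2)" using c by simp
  finally show ?thesis unfolding m_def .
qed

lemma converse_bound:
  fixes n k M :: nat and P :: real
  assumes code: "valid_code P n k M s D" and P: "P \<ge> 0" and M: "M \<ge> 1"
  shows "real k * ln (real M) * (1 - avg_error n k M s D) \<le> real n / 2 * ln (1 + real k * P) + 1"
proof -
  let ?W = "message_tuples k M" and ?X = "{1..M}"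
  define Q where "Q = real k * P"
  have Q: "Q \<ge> 0" using P by (simp add: Q_def)
  let ?P = "PiM {..<n} (\<lambda>_. gauss (1 + Q))"
  interpret P: prob_space ?P using Q by (intro prob_space_PiM prob_space_gauss) simp
  interpret Z: prob_space "noise n" by (rule prob_space_noise)
  \<comment> \<open>With this \<open>t\<close>, \<open>exp t\<close> is the number of message
    tuples. The decoding regions are disjoint and have total reference mass at most 1, so the last
    term of the change of measure bound averages to at most 1 per tuple: the additive 1 in the
    conclusion.\<close>
  define t where "t = real k * ln (real M)"
  have t: "t \<ge> 0" using M by (simp add: t_def)
  have et: "exp t = real M ^ k" using M by (simp add: t_def exp_of_nat_mult)
  \<comment> \<open>The codewords of each user are centred, and the total mean \<open>m\<close> is
    removed from the output. Otherwise the means of different users could add coherently, with power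
    of order \<open>k\<^sup>2 * P\<close> instead of \<open>k * P\<close>.\<close>
  define b where "b i j x = s j x i - (\<Sum>x'\<in>?X. s j x' i) / real M" for i j x
  define m where "m i = (\<Sum>j<k. (\<Sum>x'\<in>?X. s j x' i) / real M)" for i
  define x where "x w i = (\<Sum>j<k. b i j (w j))" for w i
  define A where "A w = {u \<in> space (out_space n). \<forall>j<k. D u j = w j}" for w
  \<comment> \<open>The decoding region of \<open>w\<close> translated by \<open>- m\<close>: the
    centred output lies in it exactly when the actual output is decoded as \<open>w\<close>.\<close>
  define B where "B w = {y \<in> space ?P. (\<lambda>i\<in>{..<n}. y i + m i) \<in> A w}" for w
  define p where "p w = measure (noise n) {z \<in> space (noise n). (\<lambda>i\<in>{..<n}. x w i + z i) \<in> B w}" for w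
  define H where "H w = (\<Sum>i<n. ln (1 + Q) / 2 + ((x w i)\<^sup>2 + 1) / (2 * (1 + Q)) - 1 / 2)" for w
  have A: "A w \<in> sets (out_space n)" for w
  proof -
    have "A w = space (out_space n) \<inter> (\<Inter>j\<in>{..<k}. {u \<in> space (out_space n). D u j = w j})"
      by (auto simp: A_def)
    also have "\<dots> \<in> sets (out_space n)"
    proof (cases "k = 0")
      case False
      then have "(\<Inter>j\<in>{..<k}. {u \<in> space (out_space n). D u j = w j}) \<in> sets (out_space n)"
        using code unfolding valid_code_def by (intro sets.finite_INT) auto
      then show ?thesis by (intro sets.Int) auto
    qed auto
    finally show ?thesis .
  qed
  have shift: "(\<lambda>y. \<lambda>i\<in>{..<n}. y i + c i) \<in> PiM {..<n} (\<lambda>_. gauss R) \<rightarrow>\<^sub>M PiM {..<n} (\<lambda>_. borel)"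
    for c :: "nat \<Rightarrow> real" and R
  proof (intro measurable_restrict borel_measurable_add borel_measurable_const)
    fix i assume "i \<in> {..<n}"
    then have "(\<lambda>y. y i) \<in> PiM {..<n} (\<lambda>_. gauss R) \<rightarrow>\<^sub>M gauss R" by (rule measurable_component_singleton)
    then show "(\<lambda>y. y i) \<in> borel_measurable (PiM {..<n} (\<lambda>_. gauss R))"
      by (simp add: measurable_cong_sets[OF refl sets_gauss])
  qed
  have B: "B w \<in> sets ?P" for w
    using measurable_sets[OF shift[of m "1 + Q"] A[of w, unfolded out_space_def]]
    by (simp add: B_def vimage_def Int_def conj_commute out_space_def)
  have out: "(\<lambda>i\<in>{..<n}. x w i + z i) \<in> B w \<longleftrightarrow> (\<forall>j<k. D (channel_output n k s w z) j = w j)" for w z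
  proof -
    have "x w i + z i + m i = (\<Sum>j<k. s j (w j) i) + z i" for i
      unfolding x_def b_def m_def by (simp add: sum_subtractf)
    then have "(\<lambda>i\<in>{..<n}. (\<lambda>i\<in>{..<n}. x w i + z i) i + m i) = channel_output n k s w z"
      unfolding channel_output_def by (intro restrict_ext) simp
    moreover have "channel_output n k s w z \<in> space (out_space n)"
      by (simp add: channel_output_def out_space_def space_PiM)
    moreover have "(\<lambda>i\<in>{..<n}. x w i + z i) \<in> space ?P" by (simp add: space_PiM)
    ultimately show ?thesis by (simp add: B_def A_def)
  qed
  have err: "measure (noise n) {z \<in> space (noise n). \<exists>j<k. D (channel_output n k s w z) j \<noteq> w j} = 1 - p w" for w
  proof -
    have "(\<lambda>z. \<lambda>i\<in>{..<n}. z i + x w i) \<in> noise n \<rightarrow>\<^sub>M ?P"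
      using shift[of "x w" 1] unfolding noise_eq
      by (simp add: measurable_cong_sets[OF refl sets_PiM_cong[OF refl sets_gauss]])
    from measurable_sets[OF this B[of w]]
    have "{z \<in> space (noise n). (\<lambda>i\<in>{..<n}. x w i + z i) \<in> B w} \<in> Z.events"
      by (simp add: vimage_def Int_def conj_commute add.commute)
    from Z.prob_compl[OF this]
    have "measure (noise n) (space (noise n) - {z \<in> space (noise n). (\<lambda>i\<in>{..<n}. x w i + z i) \<in> B w}) = 1 - p w"
      unfolding p_def .
    moreover have "space (noise n) - {z \<in> space (noise n). (\<lambda>i\<in>{..<n}. x w i + z i) \<in> B w} =
        {z \<in> space (noise n). \<exists>j<k. D (channel_output n k s w z) j \<noteq> w j}"
      using out by blast
    ultimately show ?thesis by simp
  qed
  have Mk: "real M ^ k > 0" using M by simp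
  have Pc: "real M ^ k * (1 - avg_error n k M s D) = (\<Sum>w\<in>?W. p w)"
  proof -
    have "avg_error n k M s D = (1 / real M ^ k) * (\<Sum>w\<in>?W. 1 - p w)"
      unfolding avg_error_def err message_tuples_def ..
    then show ?thesis using Mk by (simp add: sum_subtractf field_simps)
  qed
  have disj: "disjoint_family_on B ?W"
    unfolding disjoint_family_on_def
  proof (intro ballI impI)
    fix w w' assume w: "w \<in> ?W" "w' \<in> ?W" "w \<noteq> w'"
    from message_tuples_diff_nonempty[OF w] obtain j where "j < k" "w j \<noteq> w' j" by blast
    then show "B w \<inter> B w' = {}" by (auto simp: B_def A_def)
  qed
  have "(\<Sum>w\<in>?W. measure ?P (B w)) = measure ?P (\<Union>w\<in>?W. B w)"
    using B by (intro P.finite_measure_finite_Union[symmetric] disj) auto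
  then have total: "(\<Sum>w\<in>?W. measure ?P (B w)) \<le> 1" by simp
  have "t * (\<Sum>w\<in>?W. p w) = (\<Sum>w\<in>?W. t * p w)" by (rule sum_distrib_left)
  also have "\<dots> \<le> (\<Sum>w\<in>?W. H w + (exp t - 1) * measure ?P (B w))"
    unfolding p_def H_def by (intro sum_mono change_of_measure_bound Q t B)
  also have "\<dots> = (\<Sum>w\<in>?W. H w) + (exp t - 1) * (\<Sum>w\<in>?W. measure ?P (B w))"
    by (simp add: sum.distrib sum_distrib_left)
  also have "(exp t - 1) * (\<Sum>w\<in>?W. measure ?P (B w)) \<le> (exp t - 1) * 1"
    using t by (intro mult_left_mono total) simp
  also have "(\<Sum>w\<in>?W. H w) \<le> real M ^ k * (real n / 2 * ln (1 + Q))"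
  proof -
    have sq: "(\<Sum>w\<in>?W. \<Sum>i<n. (x w i)\<^sup>2) \<le> real M ^ k * (real n * Q)"
    proof -
      have "real M * (\<Sum>w\<in>?W. (x w i)\<^sup>2) = real M ^ k * (\<Sum>j<k. \<Sum>a\<in>?X. (b i j a)\<^sup>2)" for i
      proof -
        have "(\<Sum>a\<in>?X. b i j a) = 0" for j using M by (simp add: b_def sum_subtractf)
        from conjunct2[OF sum_PiE_centered_squares[of "{..<k}" ?X "b i", OF _ _ this]]
        show ?thesis by (simp add: x_def message_tuples_def)
      qed
      then have "real M * (\<Sum>w\<in>?W. \<Sum>i<n. (x w i)\<^sup>2) = real M ^ k * (\<Sum>i<n. \<Sum>j<k. \<Sum>a\<in>?X. (b i j a)\<^sup>2)"
        by (subst sum.swap) (simp add: sum_distrib_left)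
      also have "\<dots> \<le> real M ^ k * (\<Sum>i<n. \<Sum>j<k. \<Sum>a\<in>?X. (s j a i)\<^sup>2)"
      proof (rule mult_left_mono[OF sum_mono[OF sum_mono]])
        fix i j
        show "(\<Sum>a\<in>?X. (b i j a)\<^sup>2) \<le> (\<Sum>a\<in>?X. (s j a i)\<^sup>2)"
          unfolding b_def using sum_centered_squares_le[of ?X "\<lambda>a. s j a i"] M by simp
      qed simp
      also have "(\<Sum>i<n. \<Sum>j<k. \<Sum>a\<in>?X. (s j a i)\<^sup>2) = (\<Sum>j<k. \<Sum>a\<in>?X. \<Sum>i<n. (s j a i)\<^sup>2)"
        by (subst sum.swap) (rule sum.cong[OF refl sum.swap])
      also have "\<dots> \<le> (\<Sum>j<k. \<Sum>a\<in>?X. real n * P)"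
        by (intro sum_mono codeword_power[OF code]) auto
      also have "\<dots> = real M * (real n * Q)" by (simp add: Q_def)
      finally have "real M * (\<Sum>w\<in>?W. \<Sum>i<n. (x w i)\<^sup>2) \<le> real M * (real M ^ k * (real n * Q))"
        by (simp add: mult_left_mono mult.left_commute)
      then show ?thesis using M by simp
    qed
    have "(\<Sum>w\<in>?W. H w) = (\<Sum>w\<in>?W. real n * (ln (1 + Q) / 2 + 1 / (2 * (1 + Q)) - 1 / 2) + (\<Sum>i<n. (x w i)\<^sup>2) / (2 * (1 + Q)))"
      unfolding H_def by (simp add: add_divide_distrib sum.distrib sum_subtractf sum_divide_distrib right_diff_distrib distrib_left)
    also have "\<dots> = real M ^ k * (real n * (ln (1 + Q) / 2 + 1 / (2 * (1 + Q)) - 1 / 2)) + (\<Sum>w\<in>?W. \<Sum>i<n. (x w i)\<^sup>2) / (2 * (1 + Q))"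
      by (simp add: sum.distrib sum_divide_distrib)
    also have "\<dots> \<le> real M ^ k * (real n * (ln (1 + Q) / 2 + 1 / (2 * (1 + Q)) - 1 / 2)) + real M ^ k * (real n * Q) / (2 * (1 + Q))"
      using Q by (intro add_left_mono divide_right_mono sq) simp
    also have "\<dots> = real M ^ k * (real n * (ln (1 + Q) / 2 + (1 / (2 * (1 + Q)) + Q / (2 * (1 + Q)) - 1 / 2)))"
      by (simp add: algebra_simps)
    \<comment> \<open>The reference variance \<open>1 + Q\<close> is matched to the power bound
      \<open>n * Q\<close>, so that everything except the logarithm cancels.\<close>
    also have "1 / (2 * (1 + Q)) + Q / (2 * (1 + Q)) = 1 / 2"
      unfolding add_divide_distrib[symmetric] using Q by (simp add: divide_simps)
    finally show ?thesis by simp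
  qed
  finally have "t * (\<Sum>w\<in>?W. p w) \<le> real M ^ k * (real n / 2 * ln (1 + Q)) + (exp t - 1) * 1" by simp
  also have "\<dots> \<le> real M ^ k * (real n / 2 * ln (1 + Q) + 1)" unfolding et by (simp add: distrib_left)
  finally have "real M ^ k * (t * (1 - avg_error n k M s D)) \<le> real M ^ k * (real n / 2 * ln (1 + Q) + 1)"
    unfolding Pc[symmetric] by (simp add: mult_ac)
  then show ?thesis using Mk unfolding t_def Q_def by (simp add: mult_le_cancel_left_pos)
qed

lemma converse:
  fixes P \<epsilon> :: real and k :: "nat \<Rightarrow> nat"
  assumes P: "P > 0" and k1: "\<And>n. k n \<ge> 1" and \<epsilon>: "\<epsilon> > 0"
  shows "\<not> asymp_achievable P k (\<lambda>n. (1 + \<epsilon>) * (real n / (2 * real (k n)) * ln (1 + real (k n) * P)))"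
proof
  define v where "v n = (1 + \<epsilon>) * (real n / (2 * real (k n)) * ln (1 + real (k n) * P))" for n
  assume "asymp_achievable P k (\<lambda>n. (1 + \<epsilon>) * (real n / (2 * real (k n)) * ln (1 + real (k n) * P)))"
  then obtain s D where code: "\<And>n. valid_code P n (k n) (num_messages (v n)) (s n) (D n)"
    and lim: "(\<lambda>n. avg_error n (k n) (num_messages (v n)) (s n) (D n)) \<longlonglongrightarrow> 0"
    unfolding asymp_achievable_def v_def[symmetric] by blast
  define e where "e n = avg_error n (k n) (num_messages (v n)) (s n) (D n)" for n
  \<comment> \<open>\<open>q\<close> lies strictly between \<open>1 / (1 + \<epsilon>)\<close> and
    1. An error below \<open>1 - q\<close> leaves at least the factor
    \<open>q * (1 + \<epsilon>) = 1 + \<epsilon> / 2\<close> in front of \<open>n / 2 * ?g\<close>,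
    and the excess \<open>\<epsilon> / 4 * ?g * n\<close> eventually outgrows the additive 1 of the
    converse bound.\<close>
  define q where "q = (1 + \<epsilon> / 2) / (1 + \<epsilon>)"
  have q: "0 < 1 - q" "q > 0" "q * (1 + \<epsilon>) = 1 + \<epsilon> / 2" using \<epsilon> by (auto simp: q_def field_simps)
  have lp: "ln (1 + P) > 0" using P by simp
  have "eventually (\<lambda>n. e n < 1 - q) at_top"
    using order_tendstoD(2)[OF lim q(1)] unfolding e_def .
  moreover have "eventually (\<lambda>n. \<epsilon> / 4 * ln (1 + P) * real n > 1) at_top"
  proof -
    define a where "a = \<epsilon> / 4 * ln (1 + P)"
    have "a > 0" using \<epsilon> lp by (simp add: a_def)
    then show ?thesis unfolding a_def[symmetric] by real_asymp
  qed
  ultimately have "eventually (\<lambda>n :: nat. False) at_top"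
  proof eventually_elim
    case (elim n)
    let ?g = "ln (1 + real (k n) * P)"
    have g: "?g \<ge> ln (1 + P)" using ln_one_plus_pos[OF P k1[of n]] by simp
    have kp: "real (k n) > 0" using k1[of n] by simp
    have "v n \<le> ln (real (num_messages (v n)))"
    proof (rule ln_ge_iff[THEN iffD2])
      show "0 < real (num_messages (v n))" using num_messages_bounds(1)[of "v n"] by linarith
    qed (rule num_messages_bounds(2))
    then have "real (k n) * v n \<le> real (k n) * ln (real (num_messages (v n)))"
      by (intro mult_left_mono) auto
    moreover have "real (k n) * v n = (1 + \<epsilon>) * (real n / 2 * ?g)"
      using kp by (simp add: v_def)
    ultimately have up: "(1 + \<epsilon>) * (real n / 2 * ?g) \<le> real (k n) * ln (real (num_messages (v n)))" by simp
    have "0 \<le> (1 + \<epsilon>) * (real n / 2 * ?g)" using \<epsilon> g lp by (intro mult_nonneg_nonneg) auto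
    with up have "0 \<le> real (k n) * ln (real (num_messages (v n)))" by linarith
    then have "(1 + \<epsilon>) * (real n / 2 * ?g) * q \<le> real (k n) * ln (real (num_messages (v n))) * (1 - e n)"
      by (intro mult_mono[OF up]) (use elim(1) q in auto)
    also have "\<dots> \<le> real n / 2 * ?g + 1"
      unfolding e_def using P by (intro converse_bound[OF code] num_messages_bounds) simp
    finally have "(q * (1 + \<epsilon>)) * (real n / 2 * ?g) \<le> real n / 2 * ?g + 1" by (simp add: mult_ac)
    then have "\<epsilon> / 4 * ?g * real n \<le> 1" unfolding q(3) by (simp add: algebra_simps)
    moreover have "\<epsilon> / 4 * ln (1 + P) * real n \<le> \<epsilon> / 4 * ?g * real n"
      using g \<epsilon> by (intro mult_right_mono mult_left_mono) auto
    ultimately show False using elim(2) by linarith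
  qed
  then show False by (simp add: eventually_at_top_linorder)
qed

theorem theorem4:
  fixes P :: real and k :: "nat \<Rightarrow> nat"
  assumes "P > 0"
    and "\<And>n. k n \<ge> 1"
    and "(\<lambda>n. real (k n)) \<in> O(\<lambda>n. real n)"
  shows "sym_msg_length_capacity P k (\<lambda>n. real n / (2 * real (k n)) * ln (1 + real (k n) * P))"
  unfolding sym_msg_length_capacity_def
proof (intro allI impI conjI)
  fix \<epsilon> :: real
  assume "0 < \<epsilon> \<and> \<epsilon> < 1"
  then show "asymp_achievable P k (\<lambda>n. (1 - \<epsilon>) * (real n / (2 * real (k n)) * ln (1 + real (k n) * P)))"
    and "\<not> asymp_achievable P k (\<lambda>n. (1 + \<epsilon>) * (real n / (2 * real (k n)) * ln (1 + real (k n) * P)))"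
    by (simp_all only: achievability[OF assms] converse[OF assms(1,2)] not_False_eq_True)
qed

end
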